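(* Let $n\ge2$ and let $w=(w_1,\dots,w_n)$ be distributed according to the stationary distribution of the multispecies TASEP on a ring with $n$ sites of type $(1,1,\dots,1)$ (one particle of each species $1,\dots,n$). For any $1\le i<j\le n$, $$\mathbb P(w_1=j,\,w_2=i)=\frac{j-i}{n\binom n2},$$ $$\mathbb P(w_1=i,\,w_2=j)=\begin{cases}\dfrac1{n^2}+\dfrac{i(n-i)}{n^2(n-1)}, & \text{if } i=j-1,\\[2mm] \dfrac{1}{n^2}, & \text{if } i<j-1.\end{cases}$$
   Context: Multispecies TASEP on a ring with $n$ sites of type $(1,\dots,1)$: the states are the permutations $w=(w_1,\dots,w_n)$ of $\{1,\dots,n\}$, with positions taken cyclically modulo $n$ ($w_i$ is the species of the particle at site $i$). It is the continuous-time Markov chain in which every particle carries an independent rate-$1$ exponential clock; when the clock of the particle of species $j$ rings, it exchanges positions with the particle of species $k$ immediately to its left if $k>j$, and nothing happens otherwise. It has a unique stationary distribution. *)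

theory Defs
  imports "HOL-Probability.Probability" "HOL-Combinatorics.Multiset_Permutations"
begin

text \<open>
  A continuous-time Markov chain on a finite state space \<open>S\<close> is given by its jump rates:
  \<open>q u v\<close> is the rate of the jump from \<open>u\<close> to \<open>v\<close>, for \<open>u \<noteq> v\<close>. The diagonal values of
  \<open>q\<close> (clock rings that change nothing) play no role: the diagonal of the generator is
  minus the total rate of leaving the state.
\<close>

definition ctmc_generator :: "'s set \<Rightarrow> ('s \<Rightarrow> 's \<Rightarrow> real) \<Rightarrow> 's \<Rightarrow> 's \<Rightarrow> real" where
  "ctmc_generator S q u v =
     (if u = v then - (\<Sum>x\<in>S - {u}. q u x) else q u v)"

text \<open>
  A stationary distribution is a probability distribution \<open>\<pi>\<close> on \<open>S\<close> with \<open>\<pi> Q = 0\<close>,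
  where \<open>Q\<close> is the generator.
\<close>

definition stationary_distribution ::
    "'s set \<Rightarrow> ('s \<Rightarrow> 's \<Rightarrow> real) \<Rightarrow> 's pmf \<Rightarrow> bool" where
  "stationary_distribution S q \<pi> \<longleftrightarrow>
     set_pmf \<pi> \<subseteq> S \<and>
     (\<forall>v\<in>S. (\<Sum>u\<in>S. pmf \<pi> u * ctmc_generator S q u v) = 0)"

text \<open>
  A state \<open>(w\<^sub>1, \<dots>, w\<^sub>n)\<close> is a list with entries \<open>1, \<dots>, n\<close> in some order. List indices start
  at 0, so \<open>w\<^sub>k\<close> is \<open>w ! (k - 1)\<close>, and the left neighbour of index 0 is index \<open>n - 1\<close>.
\<close>

definition tasep_states :: "nat \<Rightarrow> nat list set" where
  "tasep_states n = permutations_of_set {1..n}"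

definition left_site :: "nat \<Rightarrow> nat \<Rightarrow> nat" where
  "left_site n m = (m + n - 1) mod n"

text \<open>The state after the clock of the particle at index \<open>m\<close> has rung.\<close>

definition tasep_ring :: "nat list \<Rightarrow> nat \<Rightarrow> nat list" where
  "tasep_ring w m =
     (let l = left_site (length w) m
      in if w ! l > w ! m then w[l := w ! m, m := w ! l] else w)"

text \<open>
  Every site carries exactly one particle and all clocks have rate 1, so the jump rate
  from \<open>u\<close> to \<open>v\<close> is the number of particles whose clock ring turns \<open>u\<close> into \<open>v\<close>.
\<close>

definition tasep_rate :: "nat list \<Rightarrow> nat list \<Rightarrow> real" where
  "tasep_rate u v = real (card {m. m < length u \<and> tasep_ring u m = v})"

end

(*
  Grouping the species by two thresholds a < b gives a TASEP with letters 1, 2, 3, whose stationary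
  weights are traces of products of matrices D, A, E (for 3, 2, 1) with D E = D + E, D A = A,
  A E = A. In the representation by shift operators one has moreover D E - E D = A. The first
  relation expresses the pattern 31 on a ring with n sites through one-point functions on a ring
  with n - 1 sites, the last one then gives the pattern 13. One-point functions and partition
  functions C(n,a) C(n,c) are explicit, and P(w_1 = i, w_2 = j) is a mixed second difference in the
  thresholds. On the diagonal a = b two letters suffice.
*)
theory Submission imports Defs begin

text \<open>Two facts shape the proof. First, a word in D and E alone has all diagonal entries at
  least 1, so its trace diverges: every weight needs a letter 2, that is a < b. For a = b the class
  above the threshold is therefore labelled 2 instead of 3, and the relations are used only for the
  descent 21. The ascent follows from it because w_1 <= a and w_2 <= a are equally likely events.
  Second, the descent formula stays valid at a = b, whereas the ascent formula jumps there by
  a(n-a)/(n^2(n-1)). The four threshold pairs behind w_1 = i, w_2 = j meet the diagonal only if i =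
  j - 1, and this jump at a = i is the extra term of the theorem. In the other cases the ascent
  formula is a product of a linear function of each threshold, whose mixed difference is the
  constant 1/n^2.\<close>

subsection \<open>Matrix product weights\<close>

text \<open>
  \<open>paths x\<close> is the matrix of the word \<open>x\<close> in the representation \<open>3 \<mapsto> D = 1 + d\<close>, \<open>1 \<mapsto> E = 1 + e\<close>,
  \<open>2 \<mapsto> A = |0\<rangle>\<langle>0|\<close>, where \<open>d\<close> and \<open>e\<close> are the shifts of \<open>\<nat>\<close> with \<open>d e = 1\<close>; hence
  \<open>D E = D + E\<close>, \<open>A E = A = D A\<close> and \<open>D E - E D = A\<close>. It counts lattice paths from height
  \<open>k\<close> to height \<open>l\<close>, and \<open>weight\<close> is its trace. The truncation of the trace at \<open>length x\<close> is
  harmless only for words that contain the letter 2 (\<open>paths_eq_0\<close>).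
\<close>

fun paths :: "nat list \<Rightarrow> nat \<Rightarrow> nat \<Rightarrow> real" where
  "paths [] k l = (if k = l then 1 else 0)"
| "paths (d # x) k l =
     (if d = 1 then paths x k l + (if k = 0 then 0 else paths x (k - 1) l)
      else if d = 2 then (if k = 0 then paths x 0 l else 0)
      else paths x k l + paths x (Suc k) l)"

definition weight :: "nat list \<Rightarrow> real" where
  "weight x = (\<Sum>k<length x. paths x k k)"

text \<open>The recursion of \<open>paths\<close> multiplies by a matrix on the left. This is
  multiplication on the right, needed to move a letter around the ring inside the trace.\<close>

lemma paths_snoc:
  "paths (x @ [d]) k l =
     (if d = 1 then paths x k l + paths x k (Suc l)
      else if d = 2 then (if l = 0 then paths x k 0 else 0)
      else paths x k l + (if l = 0 then 0 else paths x k (l - 1)))"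
  by (induction x arbitrary: k) auto

text \<open>The letter 2 can only be read at height 0 and each letter lowers the height by at most
  one, so a path from height k through a 2 has more than k letters.\<close>

lemma paths_eq_0: "2 \<in> set x \<Longrightarrow> length x \<le> k \<Longrightarrow> paths x k l = 0"
  by (induction x arbitrary: k) auto

lemma paths_nonneg: "paths x k l \<ge> 0"
  by (induction x arbitrary: k) auto

lemma paths_0_0_ge_1: "paths x 0 0 \<ge> 1"
proof (induction x)
  case (Cons d x)
  then show ?case using paths_nonneg[of x "Suc 0" 0] by auto
qed auto

lemma weight_pos:
  assumes "x \<noteq> []"
  shows "weight x > 0"
proof -
  have "paths x 0 0 \<le> weight x"
    unfolding weight_def using assms
    by (intro member_le_sum) (auto simp: paths_nonneg)
  then show ?thesis using paths_0_0_ge_1[of x] by linarith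
qed

text \<open>Words of different lengths get a common truncation, so that matrix relations can be
  compared entry by entry.\<close>

lemma weight_alt:
  assumes "2 \<in> set x" "length x \<le> K"
  shows "weight x = (\<Sum>k<K. paths x k k)"
  unfolding weight_def using assms
  by (intro sum.mono_neutral_left) (auto simp: paths_eq_0)

text \<open>Cyclicity of the trace. A shift moves the summation index by one, and the truncated sums
  agree because the boundary entry vanishes by \<open>paths_eq_0\<close>.\<close>

lemma weight_Cons_eq_snoc:
  assumes "2 \<in> set (d # x)"
  shows "weight (d # x) = weight (x @ [d])"
proof (cases "d = 2")
  case True
  have "weight (d # x) = (\<Sum>k<Suc (length x). if k = 0 then paths x 0 0 else 0)"
    unfolding weight_def using True by (intro sum.cong) auto
  moreover have "weight (x @ [d]) = (\<Sum>k<Suc (length x). if k = 0 then paths x 0 0 else 0)"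
    unfolding weight_def using True by (intro sum.cong) (auto simp: paths_snoc)
  ultimately show ?thesis by simp
next
  case False
  then have two: "2 \<in> set x" using assms by simp
  let ?n = "length x"
  have *: "(\<Sum>k<Suc ?n. if k = 0 then 0 else f (k - 1)) = (\<Sum>k<?n. f k)" for f :: "nat \<Rightarrow> real"
    unfolding lessThan_Suc_eq_insert_0 by (simp add: sum.reindex)
  show ?thesis
  proof (cases "d = 1")
    case True
    have "weight (d # x) = (\<Sum>k<Suc ?n. paths x k k)
        + (\<Sum>k<Suc ?n. if k = 0 then 0 else paths x (k - 1) (Suc (k - 1)))"
      unfolding weight_def sum.distrib[symmetric] using True by (intro sum.cong) auto
    \<comment> \<open>After reindexing, the right sum has the additional entry from height
      \<open>?n\<close> to \<open>Suc ?n\<close>; it is zero.\<close>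
    also have "\<dots> = (\<Sum>k<Suc ?n. paths x k k) + (\<Sum>k<Suc ?n. paths x k (Suc k))"
      using paths_eq_0[OF two order.refl] by (subst *) simp
    also have "\<dots> = weight (x @ [d])"
      unfolding weight_def sum.distrib[symmetric] using True
      by (intro sum.cong) (auto simp: paths_snoc)
    finally show ?thesis .
  next
    case False
    with \<open>d \<noteq> 2\<close> have "weight (x @ [d]) = (\<Sum>k<Suc ?n. paths x k k)
        + (\<Sum>k<Suc ?n. if k = 0 then 0 else paths x (Suc (k - 1)) (k - 1))"
      unfolding weight_def sum.distrib[symmetric]
      by (intro sum.cong) (auto simp: paths_snoc)
    also have "\<dots> = (\<Sum>k<Suc ?n. paths x k k) + (\<Sum>k<Suc ?n. paths x (Suc k) k)"
      using paths_eq_0[OF two, of "Suc ?n"] by (subst *) simp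
    also have "\<dots> = weight (d # x)"
      unfolding weight_def sum.distrib[symmetric] using False \<open>d \<noteq> 2\<close>
      by (intro sum.cong) auto
    finally show ?thesis by simp
  qed
qed

lemma weight_append_commute: "2 \<in> set (x @ y) \<Longrightarrow> weight (x @ y) = weight (y @ x)"
proof (induction x arbitrary: y)
  case (Cons d x)
  then show ?case using weight_Cons_eq_snoc[of d "x @ y"] Cons.IH[of "y @ [d]"] by auto
qed simp

lemma weight_rotate1: "2 \<in> set x \<Longrightarrow> weight (rotate1 x) = weight x"
  by (cases x) (simp_all add: weight_Cons_eq_snoc)

section \<open>Quadratic relations under the trace\<close>

lemma weight_31:
  assumes "2 \<in> set y"
  shows "weight (3 # 1 # y) = weight (3 # y) + weight (1 # y)"
proof -
  let ?K = "Suc (Suc (length y))"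
  have "weight (3 # 1 # y) = (\<Sum>k<?K. paths (3 # 1 # y) k k)"
    "weight (3 # y) = (\<Sum>k<?K. paths (3 # y) k k)"
    "weight (1 # y) = (\<Sum>k<?K. paths (1 # y) k k)"
    by (rule weight_alt; use assms in simp)+
  then show ?thesis by (simp only: sum.distrib[symmetric]) (rule sum.cong; simp)
qed

lemma weight_21: "weight (2 # 1 # y) = weight (2 # y)"
proof -
  let ?K = "Suc (Suc (length y))"
  have "weight (2 # 1 # y) = (\<Sum>k<?K. paths (2 # 1 # y) k k)"
    "weight (2 # y) = (\<Sum>k<?K. paths (2 # y) k k)"
    by (rule weight_alt; simp)+
  then show ?thesis by (simp only:) (rule sum.cong; simp)
qed

lemma weight_32: "weight (3 # 2 # y) = weight (2 # y)"
proof -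
  let ?K = "Suc (Suc (length y))"
  have "weight (3 # 2 # y) = (\<Sum>k<?K. paths (3 # 2 # y) k k)"
    "weight (2 # y) = (\<Sum>k<?K. paths (2 # y) k k)"
    by (rule weight_alt; simp)+
  then show ?thesis by (simp only:) (rule sum.cong; simp)
qed

lemma weight_13:
  assumes "2 \<in> set y"
  shows "weight (1 # 3 # y) = weight (3 # 1 # y) - weight (2 # y)"
proof -
  let ?K = "Suc (Suc (length y))"
  have "weight (3 # 1 # y) = (\<Sum>k<?K. paths (3 # 1 # y) k k)"
    "weight (1 # 3 # y) = (\<Sum>k<?K. paths (1 # 3 # y) k k)"
    "weight (2 # y) = (\<Sum>k<?K. paths (2 # y) k k)"
    by (rule weight_alt; use assms in simp)+
  then show ?thesis by (simp only: sum_subtractf[symmetric]) (rule sum.cong; simp)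
qed

subsection \<open>Stationarity and uniqueness\<close>

text \<open>
  For words of length \<open>n\<close>: invariance under ringing the clock of a uniformly chosen site, tested
  against functions. In this form projections to fewer species are immediate.
\<close>

definition invariant :: "nat \<Rightarrow> nat list set \<Rightarrow> (nat list \<Rightarrow> real) \<Rightarrow> bool" where
  "invariant n T p \<longleftrightarrow>
     (\<forall>f. (\<Sum>x\<in>T. p x * (\<Sum>m<n. f (tasep_ring x m))) = real n * (\<Sum>x\<in>T. p x * f x))"

section \<open>Clock rings as maps on words\<close>

lemma left_site_Suc: "n > 0 \<Longrightarrow> Suc k < n \<Longrightarrow> left_site n (Suc k) = k"
  by (simp add: left_site_def)

lemma left_site_0: "n > 0 \<Longrightarrow> left_site n 0 = n - 1"
  by (simp add: left_site_def)

lemma left_site_less: "n > 0 \<Longrightarrow> left_site n m < n"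
  by (simp add: left_site_def)

lemma left_site_neq: "n \<ge> 2 \<Longrightarrow> m < n \<Longrightarrow> left_site n m \<noteq> m"
  by (cases m) (auto simp: left_site_Suc left_site_0)

lemma sum_left_site:
  fixes f :: "nat \<Rightarrow> real"
  shows "(\<Sum>m<n. f (left_site n m)) = (\<Sum>m<n. f m)"
proof (cases n)
  case (Suc k)
  have "(\<Sum>m<Suc k. f (left_site n m)) = f k + (\<Sum>m<k. f m)"
    unfolding sum.lessThan_Suc_shift using Suc
    by (auto simp: left_site_0 left_site_Suc intro!: sum.cong)
  then show ?thesis using Suc by simp
qed simp

lemma length_tasep_ring [simp]: "length (tasep_ring x m) = length x"
  by (simp add: tasep_ring_def Let_def)

lemma mset_tasep_ring:
  assumes "m < length x"
  shows "mset (tasep_ring x m) = mset x"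
proof -
  have "left_site (length x) m < length x" by (rule left_site_less) (use assms in linarith)
  then show ?thesis using assms by (simp add: tasep_ring_def Let_def mset_swap)
qed

text \<open>A monotone \<open>g\<close> preserves the order of two neighbours or identifies them,
  and exchanging identified letters leaves the projected word unchanged.\<close>

lemma map_tasep_ring:
  assumes "mono g" "m < length x"
  shows "map g (tasep_ring x m) = tasep_ring (map g x) m"
proof -
  define l where "l = left_site (length x) m"
  have l: "l < length x" unfolding l_def by (rule left_site_less) (use assms in linarith)
  have ring: "tasep_ring x m = (if x ! m < x ! l then x[l := x ! m, m := x ! l] else x)"
    unfolding tasep_ring_def Let_def l_def ..
  have ring_g: "tasep_ring (map g x) m =
      (if g (x ! m) < g (x ! l) then map g (x[l := x ! m, m := x ! l]) else map g x)"
    unfolding tasep_ring_def Let_def length_map l_def[symmetric]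
    using l assms(2) by (simp add: map_update)
  have "map g (x[l := x ! m, m := x ! l]) = map g x" if "g (x ! l) = g (x ! m)"
    using that l assms(2) by (intro nth_equalityI) (auto simp: nth_list_update)
  moreover have "g (x ! m) \<le> g (x ! l)" if "x ! m < x ! l"
    using that assms(1) by (simp add: monoD)
  moreover have "g (x ! l) \<le> g (x ! m)" if "x ! l \<le> x ! m"
    using that assms(1) by (simp add: monoD)
  ultimately show ?thesis
    unfolding ring ring_g by (cases "x ! m < x ! l") (fastforce simp: not_less)+
qed

text \<open>
  The net flow through a bond is a difference of two terms, each attached to one of its two sites,
  so that the sum over the ring telescopes.
\<close>

definition drift :: "nat \<Rightarrow> real" where
  "drift d = 2 - real d"

text \<open>For p < q these are exactly the relations for 31, 21 and 32; exchanging p and q changes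
  the sign of both sides. The values 1, 0, -1 of \<open>drift\<close> are the scalars that play the
  part of the auxiliary matrices in the usual cancellation scheme of a matrix ansatz.\<close>

lemma weight_bond:
  assumes "p \<in> {1,2,3}" "q \<in> {1,2,3}" "2 \<in> set (p # q # y)"
  shows "(if p < q then weight (q # p # y) else if q < p then - weight (p # q # y) else 0)
       = drift p * weight (q # y) - drift q * weight (p # y)"
  using assms weight_31[of y] weight_21[of y] weight_32[of y]
  by (auto simp: drift_def)

definition delete_site :: "nat list \<Rightarrow> nat \<Rightarrow> nat list" where
  "delete_site v k = take k v @ drop (Suc k) v"

lemma weight_flow:
  assumes v: "set v \<subseteq> {1,2,3}" "2 \<in> set v" and n: "length v = n" "n \<ge> 2" and m: "m < n"
    and l: "l = left_site n m"
  shows "(if v ! l < v ! m then weight (v[l := v ! m, m := v ! l])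
          else if v ! m < v ! l then - weight v else 0)
       = drift (v ! l) * weight (delete_site v l) - drift (v ! m) * weight (delete_site v m)"
proof -
  define p q where "p = v ! l" and "q = v ! m"
  have "l < n" using l left_site_less n by simp
  then have pq: "p \<in> {1,2,3}" "q \<in> {1,2,3}"
    using v(1) n m unfolding p_def q_def by (meson nth_mem subsetD)+
  \<comment> \<open>The bond is rotated to the front. Products with \<open>drift\<close> are
    compared instead of bare weights: deleting the only 2 destroys cyclic invariance, but the factor
    \<open>drift 2\<close> is then 0.\<close>
  have "\<exists>y. weight v = weight (p # q # y) \<and> weight (v[l := q, m := p]) = weight (q # p # y) \<and>
      drift p * weight (delete_site v l) = drift p * weight (q # y) \<and>
      drift q * weight (delete_site v m) = drift q * weight (p # y) \<and> set v = set (p # q # y)"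
  proof (cases m)
    case 0
    then have l: "l = n - 1" using l n by (simp add: left_site_0)
    obtain a ys b where "v = a # ys @ [b]"
      using n by (cases v; cases "tl v" rule: rev_cases) auto
    then have v': "v = q # ys @ [p]" using n l 0 unfolding p_def q_def by (auto simp: nth_append)
    have "l = Suc (length ys)" using l n v' by simp
    then have *: "v[l := q, m := p] = p # ys @ [q]" "delete_site v l = q # ys" "delete_site v m = ys @ [p]"
      unfolding 0 by (auto simp: v' delete_site_def)
    have "weight v = weight (p # q # ys)"
      using weight_Cons_eq_snoc[of p "q # ys"] v(2) v' by auto
    moreover have "weight (p # ys @ [q]) = weight (q # p # ys)"
      using weight_Cons_eq_snoc[of q "p # ys"] v(2) v' by auto
    moreover have "drift q * weight (ys @ [p]) = drift q * weight (p # ys)"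
      using weight_Cons_eq_snoc[of p "ys"] v(2) v' by (cases "q = 2") (auto simp: drift_def)
    ultimately show ?thesis using * v' by (intro exI[of _ ys]) auto
  next
    case (Suc k)
    then have l: "l = k" using l n m by (simp add: left_site_Suc)
    define xs ys where "xs = take k v" and "ys = drop (Suc (Suc k)) v"
    have v': "v = xs @ p # q # ys"
      using n m l Suc unfolding xs_def ys_def p_def q_def
      by (simp add: Cons_nth_drop_Suc)
    have len: "length xs = k" using n m Suc unfolding xs_def by simp
    have *: "v[l := q, m := p] = xs @ q # p # ys" "delete_site v l = xs @ q # ys"
        "delete_site v m = xs @ p # ys"
      unfolding Suc l using len by (auto simp: v' delete_site_def list_update_append)
    have "weight v = weight (p # q # ys @ xs)"
      using weight_append_commute[of xs "p # q # ys"] v(2) v' by auto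
    moreover have "weight (xs @ q # p # ys) = weight (q # p # ys @ xs)"
      using weight_append_commute[of xs "q # p # ys"] v(2) v' by auto
    moreover have "drift q * weight (xs @ p # ys) = drift q * weight (p # ys @ xs)"
      using weight_append_commute[of xs "p # ys"] v(2) v' by (cases "q = 2") (auto simp: drift_def)
    moreover have "drift p * weight (xs @ q # ys) = drift p * weight (q # ys @ xs)"
      using weight_append_commute[of xs "q # ys"] v(2) v' by (cases "p = 2") (auto simp: drift_def)
    ultimately show ?thesis using * v' by (intro exI[of _ "ys @ xs"]) auto
  qed
  then obtain y where y: "weight v = weight (p # q # y)" "weight (v[l := q, m := p]) = weight (q # p # y)"
      "drift p * weight (delete_site v l) = drift p * weight (q # y)"
      "drift q * weight (delete_site v m) = drift q * weight (p # y)" "set v = set (p # q # y)"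
    by blast
  show ?thesis
    unfolding p_def[symmetric] q_def[symmetric] y(1-4)
    using weight_bond[OF pq, of y] v(2) y(5) by auto
qed

text \<open>After a ring at m the letter at l is at most the letter at m. Hence v has the two
  preimages v and its exchange if this inequality is strict, only itself in case of equality, and
  none otherwise.\<close>

lemma sum_weight_preimages:
  assumes v: "set v \<subseteq> {1,2,3}" "2 \<in> set v" and n: "length v = n" "n \<ge> 2" and m: "m < n"
    and l: "l = left_site n m"
  shows "(\<Sum>u | mset u = mset v \<and> tasep_ring u m = v. weight u) - weight v
       = drift (v ! l) * weight (delete_site v l) - drift (v ! m) * weight (delete_site v m)"
proof -
  define s where "s u = u[l := u ! m, m := u ! l]" for u :: "nat list"
  have ln: "l < n" using l left_site_less n by simp
  have lm: "l \<noteq> m" using l left_site_neq[OF n(2) m] by simp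
  have ring: "tasep_ring u m = (if u ! l > u ! m then s u else u)" if "length u = n" for u
    using that l by (simp add: tasep_ring_def Let_def s_def)
  have ss: "s (s u) = u" if "length u = n" for u
    unfolding s_def using that ln m lm by (intro nth_equalityI) (auto simp: nth_list_update)
  have smset: "mset (s u) = mset u" if "length u = n" for u
    unfolding s_def using that ln m by (simp add: mset_swap)
  have snth: "s u ! l = u ! m" "s u ! m = u ! l" if "length u = n" for u
    unfolding s_def using that ln m lm by (auto simp: nth_list_update)
  have slen: "length (s u) = length u" for u unfolding s_def by simp
  have len: "length u = n" if "mset u = mset v" for u using that n mset_eq_length by blast
  have "{u. mset u = mset v \<and> tasep_ring u m = v} =
      (if v ! l < v ! m then {v, s v} else if v ! m < v ! l then {} else {v})"
    (is "?A = ?B")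
  proof (intro set_eqI iffI)
    fix u assume "u \<in> ?A"
    then have u: "mset u = mset v" "tasep_ring u m = v" by auto
    show "u \<in> ?B"
      using u(2) ring[OF len[OF u(1)]] ss[OF len[OF u(1)]] snth[OF len[OF u(1)]]
      by (auto split: if_splits)
  next
    fix u assume u: "u \<in> ?B"
    show "u \<in> ?A"
    proof (cases "u = v")
      case True
      then show ?thesis using u ring[OF n(1)] by (auto split: if_splits)
    next
      case False
      then have "u = s v" "v ! l < v ! m" using u by (auto split: if_splits)
      then show ?thesis
        using ring[of "s v"] ss[OF n(1)] snth[OF n(1)] smset[OF n(1)] slen[of v] n(1) by auto
    qed
  qed
  moreover have "v \<noteq> s v" if "v ! l < v ! m" using snth[OF n(1)] that by force
  ultimately have "(\<Sum>u | mset u = mset v \<and> tasep_ring u m = v. weight u) - weight v =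
     (if v ! l < v ! m then weight (s v) else if v ! m < v ! l then - weight v else 0)"
    by auto
  then show ?thesis
    using weight_flow[OF v n m l] unfolding s_def by simp
qed

lemma invariant_weight:
  assumes T: "T = permutations_of_multiset M" and M: "set_mset M \<subseteq> {1,2,3}" "2 \<in># M"
    and n: "size M = n" "n \<ge> 2"
  shows "invariant n T weight"
  unfolding invariant_def
proof
  fix f :: "nat list \<Rightarrow> real"
  have fin: "finite T" unfolding T by simp
  have inT: "x \<in> T \<longleftrightarrow> mset x = M" for x unfolding T by (auto simp: permutations_of_multiset_def)
  have len: "length x = n" if "x \<in> T" for x using that n by (auto simp: inT)
  have "(\<Sum>x\<in>T. weight x * (\<Sum>m<n. f (tasep_ring x m))) =
      (\<Sum>m<n. \<Sum>x\<in>T. weight x * f (tasep_ring x m))"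
    by (simp add: sum_distrib_left sum.swap[of _ T])
  also have "\<dots> = (\<Sum>m<n. \<Sum>v\<in>T. \<Sum>x\<in>{x \<in> T. tasep_ring x m = v}. weight x * f (tasep_ring x m))"
    by (intro sum.cong refl sum.group[symmetric] fin) (auto simp: inT mset_tasep_ring len)
  also have "\<dots> = (\<Sum>v\<in>T. \<Sum>m<n. \<Sum>x\<in>{x \<in> T. tasep_ring x m = v}. weight x * f v)"
    by (subst sum.swap) simp
  also have "\<dots> = (\<Sum>v\<in>T. real n * (weight v * f v))"
  proof (intro sum.cong refl)
    fix v assume v: "v \<in> T"
    then have mv: "mset v = M" by (simp add: inT)
    then have sv: "set v \<subseteq> {1,2,3}" "2 \<in> set v" using M by auto
    have eq: "{x \<in> T. tasep_ring x m = v} = {u. mset u = mset v \<and> tasep_ring u m = v}" for m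
      using v by (auto simp: inT)
    let ?d = "\<lambda>k. drift (v ! k) * weight (delete_site v k)"
    have "(\<Sum>m<n. \<Sum>x\<in>{x \<in> T. tasep_ring x m = v}. weight x) =
       (\<Sum>m<n. weight v + (?d (left_site n m) - ?d m))"
      using sum_weight_preimages[OF sv len[OF v] n(2)] unfolding eq
      by (intro sum.cong) (auto simp: algebra_simps)
    also have "\<dots> = real n * weight v"
      by (simp add: sum.distrib sum_subtractf sum_left_site[of ?d])
    finally show "(\<Sum>m<n. \<Sum>x\<in>{x \<in> T. tasep_ring x m = v}. weight x * f v) = real n * (weight v * f v)"
      by (simp add: sum_distrib_right[symmetric])
  qed
  finally show "(\<Sum>x\<in>T. weight x * (\<Sum>m<n. f (tasep_ring x m))) = real n * (\<Sum>x\<in>T. weight x * f x)"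
    by (simp add: sum_distrib_left)
qed

text \<open>Adjacent exchanges connect all words of the same content: the first letter of x is moved
  to the front of y, and the induction continues on the tails with \<open>f\<close> precomposed with
  that letter.\<close>

lemma mset_eq_adjacent_swaps:
  assumes swap: "\<And>xs p q ys. mset (xs @ p # q # ys) = M \<Longrightarrow> f (xs @ p # q # ys) = f (xs @ q # p # ys)"
    and "mset x = M" "mset y = M"
  shows "f x = f y"
  using assms
proof (induction x arbitrary: y M f)
  case (Cons d x)
  note swp = Cons.prems(1)
  have "d \<in> set y" using Cons.prems by (metis list.set_intros(1) mset_eq_setD)
  then obtain u v where y: "y = u @ d # v" by (auto simp: in_set_conv_decomp)
  \<comment> \<open>The prefix w collects the letters that d has yet to pass.\<close>
  have "mset (w @ u @ d # v) = M \<Longrightarrow> f (w @ u @ d # v) = f (w @ d # u @ v)" for w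
  proof (induction u arbitrary: w)
    case (Cons e u)
    show ?case
      using Cons.IH[of "w @ [e]"] Cons.prems swp[of w e d "u @ v"] by simp
  qed simp
  from this[of "[]"] have "f y = f (d # u @ v)" using Cons.prems y by simp
  moreover have "f (d # x) = f (d # u @ v)"
  proof (rule Cons.IH[where f = "\<lambda>z. f (d # z)" and M = "mset x"])
    fix xs p q ys assume "mset (xs @ p # q # ys) = mset x"
    then show "f (d # xs @ p # q # ys) = f (d # xs @ q # p # ys)"
      using Cons.prems(1)[of "d # xs" p q ys] Cons.prems(2) by auto
  qed (use Cons.prems y in auto)
  ultimately show ?case by simp
qed auto

text \<open>
  The Dirichlet form of the density \<open>p / w\<close> vanishes, so this density is unchanged by every clock
  ring; no irreducibility of the directed chain is needed.
\<close>

lemma invariant_unique: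
  assumes T: "T = permutations_of_multiset M" and n: "size M = n" "n \<ge> 2"
    and w: "invariant n T w" "\<And>x. x \<in> T \<Longrightarrow> w x > 0" and p: "invariant n T p"
  shows "\<exists>C. \<forall>x\<in>T. p x = C * w x"
proof -
  have fin: "finite T" unfolding T by simp
  have inT: "x \<in> T \<longleftrightarrow> mset x = M" for x unfolding T by (auto simp: permutations_of_multiset_def)
  have len: "length x = n" if "x \<in> T" for x using that n by (auto simp: inT)
  define r where "r x = p x / w x" for x
  have p_eq: "p x = r x * w x" if "x \<in> T" for x using w(2)[OF that] by (simp add: r_def)
  have "(\<Sum>x\<in>T. w x * (\<Sum>m<n. (r x - r (tasep_ring x m))\<^sup>2)) =
      (\<Sum>x\<in>T. real n * (w x * (r x)\<^sup>2) + w x * (\<Sum>m<n. (r (tasep_ring x m))\<^sup>2)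
          - 2 * (p x * (\<Sum>m<n. r (tasep_ring x m))))"
    by (intro sum.cong refl)
      (simp add: p_eq power2_diff sum.distrib sum_subtractf sum_distrib_left algebra_simps)
  \<comment> \<open>Invariance of \<open>w\<close> is tested with the square of r, that of
    \<open>p\<close> with r itself. All three terms become multiples of the same sum and
    cancel.\<close>
  also have "\<dots> = real n * (\<Sum>x\<in>T. w x * (r x)\<^sup>2) + real n * (\<Sum>x\<in>T. w x * (r x)\<^sup>2)
      - 2 * (real n * (\<Sum>x\<in>T. p x * r x))"
    using w(1)[unfolded invariant_def, rule_format, of "\<lambda>x. (r x)\<^sup>2"]
      p[unfolded invariant_def, rule_format, of r]
    by (simp add: sum.distrib sum_subtractf sum_distrib_left[symmetric])
  also have "(\<Sum>x\<in>T. p x * r x) = (\<Sum>x\<in>T. w x * (r x)\<^sup>2)"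
    by (intro sum.cong refl) (simp add: p_eq power2_eq_square)
  finally have "(\<Sum>x\<in>T. w x * (\<Sum>m<n. (r x - r (tasep_ring x m))\<^sup>2)) = 0" by simp
  then have "\<forall>x\<in>T. w x * (\<Sum>m<n. (r x - r (tasep_ring x m))\<^sup>2) = 0"
    using fin w(2) by (subst (asm) sum_nonneg_eq_0_iff) (auto intro!: mult_nonneg_nonneg sum_nonneg intro: less_imp_le)
  then have "(\<Sum>m<n. (r x - r (tasep_ring x m))\<^sup>2) = 0" if "x \<in> T" for x
    using w(2)[OF that] that by (metis less_irrefl mult_eq_0_iff)
  then have "\<forall>x\<in>T. \<forall>m<n. (r x - r (tasep_ring x m))\<^sup>2 = 0"
    by (simp add: sum_nonneg_eq_0_iff)
  then have r: "r (tasep_ring x m) = r x" if "mset x = M" "m < n" for x m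
    using that inT by auto
  have "r (xs @ p # q # ys) = r (xs @ q # p # ys)" if "mset (xs @ p # q # ys) = M" for xs p q ys
  proof -
    let ?m = "Suc (length xs)"
    have l: "?m < n" "left_site n ?m = length xs"
      using n that by (auto simp: left_site_Suc)
    \<comment> \<open>The ring exchanges only a descending pair, but equality of r is symmetric, so
      the ascending pair is covered too.\<close>
    have *: "r (xs @ p # q # ys) = r (xs @ q # p # ys)"
      if "mset (xs @ p # q # ys) = M" "q < p" for p q
    proof -
      have "tasep_ring (xs @ p # q # ys) ?m = xs @ q # p # ys"
        using that l n unfolding tasep_ring_def Let_def
        by (auto simp: nth_append list_update_append left_site_Suc)
      then show ?thesis using r[OF that(1) l(1)] by simp
    qed
    show ?thesis using *[of p q] *[of q p] that by (cases p q rule: linorder_cases) (auto simp: add_mset_commute)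
  qed
  then have "r x = r y" if "x \<in> T" "y \<in> T" for x y
    using mset_eq_adjacent_swaps[of M r x y] that by (auto simp: inT)
  then obtain C where "\<forall>x\<in>T. r x = C" by metis
  then show ?thesis using p_eq by auto
qed

subsection \<open>The partition function\<close>

text \<open>
  A pair \<open>(s, t)\<close> records an arrival \<open>s\<close> and a service \<open>t\<close> at one site. A site without service
  is labelled 3, a used service 1 and an unused service 2 (Ferrari and Martin's two-line queues);
  the lattice path is the queue length. With more services than arrivals there is exactly one
  periodic queue length, so the total weight just counts pairs of subsets of the ring.
\<close>

fun queue_step :: "nat \<Rightarrow> bool \<times> bool \<Rightarrow> nat" where
  "queue_step k (s, t) = k + of_bool s - of_bool t"

fun queue_letter :: "nat \<Rightarrow> bool \<times> bool \<Rightarrow> nat" where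
  "queue_letter k (s, t) = (if \<not> t then 3 else if k = 0 \<and> \<not> s then 2 else 1)"

fun queue_end :: "nat \<Rightarrow> (bool \<times> bool) list \<Rightarrow> nat" where
  "queue_end k [] = k"
| "queue_end k (p # ps) = queue_end (queue_step k p) ps"

fun queue_word :: "nat \<Rightarrow> (bool \<times> bool) list \<Rightarrow> nat list" where
  "queue_word k [] = []"
| "queue_word k (p # ps) = queue_letter k p # queue_word (queue_step k p) ps"

lemma length_queue_word [simp]: "length (queue_word k ps) = length ps"
  by (induction k ps rule: queue_word.induct) auto

lemma set_queue_word: "set (queue_word k ps) \<subseteq> {1,2,3}"
proof (induction ps arbitrary: k)
  case (Cons p ps)
  obtain s t where p: "p = (s, t)" by force
  show ?case using Cons[of "queue_step k p"] unfolding p by (cases s; cases t) simp_all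
qed simp

lemma count_queue_word_3: "count (mset (queue_word k ps)) 3 = length (filter (Not \<circ> snd) ps)"
proof (induction ps arbitrary: k)
  case (Cons p ps)
  obtain s t where p: "p = (s, t)" by force
  show ?case using Cons[of "queue_step k p"] unfolding p by (cases s; cases t) simp_all
qed simp

text \<open>Conservation of customers: served plus still waiting equals initially waiting plus
  arrived.\<close>

lemma count_queue_word_1:
  "count (mset (queue_word k ps)) 1 + queue_end k ps = k + length (filter fst ps)"
proof (induction ps arbitrary: k)
  case (Cons p ps)
  obtain s t where p: "p = (s, t)" by force
  show ?case using Cons[of "queue_step k p"] unfolding p by (cases s; cases t; cases k) simp_all
qed simp

lemma queue_end_le: "queue_end k ps \<le> k + length (filter fst ps)"
  using count_queue_word_1[of k ps] by linarith

lemma finite_queue_word: "finite {ps. queue_word k ps = x \<and> queue_end k ps = l}"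
  by (rule finite_subset[OF _ finite_lists_length_eq[of UNIV "length x"]])
    (auto dest: arg_cong[of _ _ length])

text \<open>At queue length k the letter d admits exactly those pairs \<open>(s, t)\<close> whose
  next queue lengths are the heights reached in the recursion of \<open>paths\<close>. The trace
  thus counts periodic queue histories.\<close>

lemma paths_eq_card:
  assumes "set x \<subseteq> {1,2,3}"
  shows "paths x k l = real (card {ps. queue_word k ps = x \<and> queue_end k ps = l})"
  using assms
proof (induction x arbitrary: k)
  case Nil
  have "{ps. queue_word k ps = [] \<and> queue_end k ps = l} = (if k = l then {[]} else {})"
    by (auto elim: queue_word.elims)
  then show ?case by simp
next
  case (Cons d x)
  define A where "A j = {ps. queue_word j ps = x \<and> queue_end j ps = l}" for j
  have "{ps. queue_word k ps = d # x \<and> queue_end k ps = l} =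
      (\<Union>p\<in>{p. queue_letter k p = d}. (#) p ` A (queue_step k p))"
  proof (intro set_eqI iffI)
    fix ps assume ps: "ps \<in> {ps. queue_word k ps = d # x \<and> queue_end k ps = l}"
    then obtain p qs where "ps = p # qs" by (cases ps) auto
    then show "ps \<in> (\<Union>p\<in>{p. queue_letter k p = d}. (#) p ` A (queue_step k p))"
      using ps by (simp add: A_def image_iff del: queue_letter.simps queue_step.simps)
  qed (auto simp: A_def simp del: queue_letter.simps queue_step.simps)
  also have "real (card \<dots>) = real (\<Sum>p | queue_letter k p = d. card ((#) p ` A (queue_step k p)))"
    by (subst card_UN_disjoint) (auto simp: A_def finite_queue_word simp del: queue_letter.simps)
  also have "\<dots> = (\<Sum>p | queue_letter k p = d. real (card (A (queue_step k p))))"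
    by (simp add: card_image)
  also have "\<dots> = (\<Sum>p | queue_letter k p = d. paths x (queue_step k p) l)"
    using Cons by (simp add: A_def)
  also have "{p. queue_letter k p = d} =
      (if d = 1 then insert (True, True) (if k = 0 then {} else {(False, True)})
       else if d = 2 then (if k = 0 then {(False, True)} else {})
       else {(False, False), (True, False)})"
  proof (intro set_eqI)
    fix p :: "bool \<times> bool"
    obtain s t where p: "p = (s, t)" by force
    show "p \<in> {p. queue_letter k p = d} \<longleftrightarrow> p \<in> (if d = 1
       then insert (True, True) (if k = 0 then {} else {(False, True)})
       else if d = 2 then (if k = 0 then {(False, True)} else {})
       else {(False, False), (True, False)})"
      using Cons.prems unfolding p by (cases s; cases t) auto
  qed
  finally show ?case by auto
qed

text \<open>One step is k -> max (k + s - t) 0, and maps of the form k -> max (k + d) r are closed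
  under composition.\<close>

lemma queue_end_eq_max:
  "\<exists>r. \<forall>k. int (queue_end k ps) =
     max (int k + int (length (filter fst ps)) - int (length (filter snd ps))) r"
proof (induction ps)
  case (Cons p ps)
  obtain s t where p: "p = (s, t)" by force
  define d where "d = int (length (filter fst ps)) - int (length (filter snd ps))"
  obtain r where r: "int (queue_end k ps) = max (int k + d) r" for k
    using Cons.IH unfolding d_def by (auto simp: algebra_simps)
  \<comment> \<open>The bound 0 of the first step is shifted by the remaining balance d, whence the
    new bound \<open>max d r\<close>.\<close>
  have "int (queue_end k (p # ps)) = max (int k + (of_bool s - of_bool t + d)) (max d r)" for k
    unfolding p queue_end.simps r by (cases s; cases t; cases k) auto
  moreover have "int (length (filter fst (p # ps))) - int (length (filter snd (p # ps)))
      = of_bool s - of_bool t + d"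
    by (simp add: p d_def)
  ultimately show ?case
    unfolding add_diff_eq[symmetric] by (intro exI[of _ "max d r"]) simp
qed (auto intro!: exI[of _ 0])

text \<open>With fewer arrivals than services a fixed point cannot come from the first branch of the
  maximum, so it must be r.\<close>

lemma ex1_queue_fixpoint:
  assumes "length (filter fst ps) < length (filter snd ps)"
  shows "\<exists>!k. queue_end k ps = k"
proof -
  obtain r where r: "int (queue_end k ps) =
     max (int k + int (length (filter fst ps)) - int (length (filter snd ps))) r" for k
    using queue_end_eq_max by blast
  have eq: "queue_end k ps = k \<longleftrightarrow> int k = r" for k using r[of k] assms by linarith
  have "r \<ge> 0" using r[of 0] assms by linarith
  then show ?thesis unfolding eq by (intro ex1I[of _ "nat r"]) auto
qed

section \<open>Enumeration of words and of pairs of rows\<close>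

definition tri_mset :: "nat \<Rightarrow> nat \<Rightarrow> nat \<Rightarrow> nat multiset" where
  "tri_mset a m c = replicate_mset a 1 + replicate_mset m 2 + replicate_mset c 3"

lemma size_tri_mset [simp]: "size (tri_mset a m c) = a + m + c"
  by (simp add: tri_mset_def)

lemma mset_eq_tri_mset_iff:
  assumes "set x \<subseteq> {1,2,3}" "length x = a + m + c"
  shows "mset x = tri_mset a m c \<longleftrightarrow> count (mset x) 1 = a \<and> count (mset x) 3 = c"
proof
  assume *: "count (mset x) 1 = a \<and> count (mset x) 3 = c"
  have "(\<Sum>d\<in>{1,2,3}. count (mset x) d) = (\<Sum>d\<in>set_mset (mset x). count (mset x) d)"
    using assms(1) by (intro sum.mono_neutral_right) (auto simp: count_mset_0_iff)
  also have "\<dots> = length x"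
    unfolding size_multiset_overloaded_eq[symmetric] by simp
  finally have "count (mset x) 2 = m" using * assms(2) by simp
  moreover have "count (mset x) d = 0" if "d \<notin> {1,2,3}" for d
    using that assms(1) by (auto simp: count_eq_zero_iff)
  ultimately show "mset x = tri_mset a m c"
    using * by (intro multiset_eqI) (auto simp: tri_mset_def)
qed (simp add: tri_mset_def)

lemma card_bool_lists:
  "finite {bs :: bool list. length bs = n \<and> length (filter (\<lambda>b. b) bs) = a} \<and>
   card {bs :: bool list. length bs = n \<and> length (filter (\<lambda>b. b) bs) = a} = n choose a"
proof (induction n arbitrary: a)
  case 0
  have "{bs :: bool list. length bs = 0 \<and> length (filter (\<lambda>b. b) bs) = a} = (if a = 0 then {[]} else {})"
    by auto
  then show ?case by (simp only:) simp
next
  case (Suc n)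
  let ?L = "\<lambda>n a. {bs :: bool list. length bs = n \<and> length (filter (\<lambda>b. b) bs) = a}"
  show ?case
  proof (cases a)
    case 0
    have "?L (Suc n) 0 = (#) False ` ?L n 0"
      by (auto simp: length_Suc_conv image_iff split: if_splits)
    then show ?thesis using Suc[of 0] 0 by (simp add: card_image)
  next
    case (Suc b)
    have "?L (Suc n) (Suc b) = (#) False ` ?L n (Suc b) \<union> (#) True ` ?L n b"
      by (auto simp: length_Suc_conv image_iff split: if_splits)
    moreover have "(#) False ` ?L n (Suc b) \<inter> (#) True ` ?L n b = {}" by auto
    ultimately show ?thesis using Suc.IH[of b] Suc.IH[of "Suc b"] Suc
      by (simp add: card_Un_disjoint card_image)
  qed
qed

text \<open>The rows of arrivals and services are independent. The second row is negated because c
  counts the sites without service, which carry the letter 3.\<close>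

lemma card_bool_pair_lists:
  "finite {ps :: (bool \<times> bool) list. length ps = n \<and> length (filter fst ps) = a \<and>
      length (filter (Not \<circ> snd) ps) = c} \<and>
   card {ps :: (bool \<times> bool) list. length ps = n \<and> length (filter fst ps) = a \<and>
      length (filter (Not \<circ> snd) ps) = c} = (n choose a) * (n choose c)"
proof -
  let ?L = "\<lambda>a. {bs :: bool list. length bs = n \<and> length (filter (\<lambda>b. b) bs) = a}"
  let ?P = "{ps :: (bool \<times> bool) list. length ps = n \<and> length (filter fst ps) = a \<and>
      length (filter (Not \<circ> snd) ps) = c}"
  have f: "length (filter fst ps) = length (filter (\<lambda>b. b) (map fst ps))"
    "length (filter (Not \<circ> snd) ps) = length (filter (\<lambda>b. b) (map (Not \<circ> snd) ps))"
    for ps :: "(bool \<times> bool) list"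
    by (simp_all add: filter_map comp_def)
  have g: "map (Not \<circ> snd) (zip xs (map Not ys)) = ys" if "length xs = length ys" for xs :: "bool list" and ys
    using that by (induction xs ys rule: list_induct2) auto
  have e: "length (filter fst (zip xs (map Not ys))) = length (filter (\<lambda>b. b) xs)"
    "length (filter (Not \<circ> snd) (zip xs (map Not ys))) = length (filter (\<lambda>b. b) ys)"
    if "length xs = length ys" for xs ys
    using that by (induction xs ys rule: list_induct2) auto
  have h: "zip (map fst ps) (map Not (map (Not \<circ> snd) ps)) = ps" for ps :: "(bool \<times> bool) list"
    by (induction ps) auto
  have "bij_betw (\<lambda>ps. (map fst ps, map (Not \<circ> snd) ps)) ?P (?L a \<times> ?L c)"
  proof (rule bij_betw_byWitness[where f' = "\<lambda>(xs, ys). zip xs (map Not ys)"])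
    show "\<forall>ps\<in>?P. (case (map fst ps, map (Not \<circ> snd) ps) of (xs, ys) \<Rightarrow> zip xs (map Not ys)) = ps"
      using h by simp
    show "\<forall>z\<in>?L a \<times> ?L c. (map fst (case z of (xs, ys) \<Rightarrow> zip xs (map Not ys)),
        map (Not \<circ> snd) (case z of (xs, ys) \<Rightarrow> zip xs (map Not ys))) = z"
      using g by auto
    show "(\<lambda>ps. (map fst ps, map (Not \<circ> snd) ps)) ` ?P \<subseteq> ?L a \<times> ?L c"
      unfolding f by auto
    show "(\<lambda>(xs, ys). zip xs (map Not ys)) ` (?L a \<times> ?L c) \<subseteq> ?P"
      using e by auto
  qed
  note bij = this
  have "finite (?L a \<times> ?L c)" "card (?L a \<times> ?L c) = (n choose a) * (n choose c)"
    using card_bool_lists[of n] by (auto simp: card_cartesian_product)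
  then show ?thesis using bij_betw_finite[OF bij] bij_betw_same_card[OF bij]
    by (simp only: simp_thms)
qed

lemma sum_weight:
  assumes "m > 0"
  shows "(\<Sum>x | mset x = tri_mset a m c. weight x) =
           real ((a + m + c) choose a) * real ((a + m + c) choose c)"
proof -
  define n where "n = a + m + c"
  let ?W = "{x. mset x = tri_mset a m c}"
  let ?P = "{ps :: (bool \<times> bool) list. length ps = n \<and> length (filter fst ps) = a \<and>
      length (filter (Not \<circ> snd) ps) = c}"
  let ?F = "\<lambda>k x. {ps. queue_word k ps = x \<and> queue_end k ps = k}"
  have finW: "finite ?W" using finite_permutations_of_multiset[of "tri_mset a m c"]
    by (simp add: permutations_of_multiset_def)
  have len: "length x = n" if "x \<in> ?W" for x
    using that unfolding n_def by (metis (mono_tags) mem_Collect_eq size_mset size_tri_mset)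
  have setx: "set x \<subseteq> {1,2,3}" if "x \<in> ?W" for x
    using that by (auto simp: tri_mset_def simp flip: set_mset_mset split: if_splits)
  have finP: "finite ?P" using card_bool_pair_lists by blast
  \<comment> \<open>For a periodic queue the letters 1 are as many as the arrivals and the letters 3
    as many as the sites without service, so the two rows determine the content of the word.\<close>
  have UN: "(\<Union>x\<in>?W. ?F k x) = {ps \<in> ?P. queue_end k ps = k}" for k
  proof -
    have "queue_word k ps \<in> ?W \<longleftrightarrow> ps \<in> ?P" if "queue_end k ps = k" for ps
    proof (cases "length ps = n")
      case True
      then show ?thesis
        using mset_eq_tri_mset_iff[of "queue_word k ps" a m c] set_queue_word[of k ps]
          count_queue_word_1[of k ps] count_queue_word_3[of k ps] that
        by (auto simp: n_def)
    next
      case False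
      then show ?thesis using len[of "queue_word k ps"] by auto
    qed
    then show ?thesis by auto
  qed
  have "(\<Sum>x\<in>?W. weight x) = (\<Sum>x\<in>?W. \<Sum>k<n. real (card (?F k x)))"
    unfolding weight_def using setx len by (intro sum.cong) (auto simp: paths_eq_card)
  also have "\<dots> = (\<Sum>k<n. real (\<Sum>x\<in>?W. card (?F k x)))"
    by (subst sum.swap) simp
  also have "\<dots> = (\<Sum>k<n. real (card (\<Union>x\<in>?W. ?F k x)))"
    by (intro sum.cong refl arg_cong[of _ _ real] card_UN_disjoint[symmetric])
      (auto simp: finite_queue_word finW)
  also have "\<dots> = (\<Sum>k<n. \<Sum>ps\<in>?P. if queue_end k ps = k then 1 else 0)"
    unfolding UN using finP by (simp add: sum.If_cases Int_def)
  also have "\<dots> = (\<Sum>ps\<in>?P. \<Sum>k<n. if queue_end k ps = k then 1 else 0)"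
    by (rule sum.swap)
  also have "\<dots> = (\<Sum>ps\<in>?P. 1)"
  proof (intro sum.cong refl)
    fix ps assume ps: "ps \<in> ?P"
    have "length (filter snd ps) + length (filter (Not \<circ> snd) ps) = n"
      using ps sum_length_filter_compl[of snd ps] by (simp add: comp_def)
    \<comment> \<open>There are n - c = a + m services for a arrivals.\<close>
    then have less: "length (filter fst ps) < length (filter snd ps)"
      using ps assms unfolding n_def by auto
    obtain k where k: "queue_end k ps = k" "\<And>j. queue_end j ps = j \<Longrightarrow> j = k"
      using ex1_queue_fixpoint[OF less] by blast
    \<comment> \<open>The fixed point must fall inside the truncation of the trace. An initially
      empty queue already ends at it, so it is at most the number a of arrivals.\<close>
    have "k < n"
    proof -
      have "queue_end 0 ps = k"
      proof -
        obtain r where r: "int (queue_end k ps) =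
           max (int k + int (length (filter fst ps)) - int (length (filter snd ps))) r" for k
          using queue_end_eq_max by blast
        show ?thesis using r[of 0] r[of k] k(1) less by linarith
      qed
      then have "k \<le> a" using queue_end_le[of 0 ps] ps by simp
      then show ?thesis using assms by (simp add: n_def)
    qed
    have "queue_end j ps = j \<longleftrightarrow> j = k" for j
      using k by blast
    then show "(\<Sum>k<n. if queue_end k ps = k then 1 else 0 :: real) = 1"
      using \<open>k < n\<close> by simp
  qed
  also have "\<dots> = real ((n choose a) * (n choose c))"
    using card_bool_pair_lists[of n a c] by simp
  finally show ?thesis by (simp add: n_def)
qed

subsection \<open>Two-point sums of weights\<close>

lemma sum_of_bool_nth_eq:
  "(\<Sum>k<length x. if x ! k = d then 1 else 0 :: real) = real (count (mset x) d)"
  by (induction x) (simp_all add: sum.lessThan_Suc_shift del: sum.lessThan_Suc)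

lemma finite_mset_eq: "finite {x. mset x = M \<and> P x}"
  using finite_permutations_of_multiset[of M]
  by (rule finite_subset[rotated]) (auto simp: permutations_of_multiset_def)

lemma sum_if_Collect:
  fixes f :: "'a \<Rightarrow> real"
  assumes "finite {x. P x}"
  shows "(\<Sum>x | P x \<and> Q x. f x) = (\<Sum>x | P x. if Q x then f x else 0)"
  using assms by (simp add: sum.If_cases Int_def)

lemma sum_rotate1:
  fixes g :: "'a list \<Rightarrow> real"
  shows "(\<Sum>x | mset x = M. g (rotate1 x)) = (\<Sum>x | mset x = M. g x)"
proof -
  have inj: "inj_on rotate1 A" for A :: "'a list set"
    by (metis bij_is_inj bij_rotate1 inj_on_subset subset_UNIV)
  have "mset (rotate1 x) = mset x" for x :: "'a list" by (cases x) auto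
  then have "rotate1 ` {x. mset x = M} = {x. mset x = M}"
    using finite_mset_eq[of M "\<lambda>_. True"] inj by (intro endo_inj_surj) auto
  then show ?thesis using sum.reindex[OF inj, of g "{x. mset x = M}"] by simp
qed

text \<open>By rotation the sum is the same for every site k, and over all sites the indicators add
  up to the number of letters d, which is common to all words.\<close>

lemma sum_weight_nth:
  assumes "m > 0" "k < a + m + c" "n = a + m + c"
  shows "(\<Sum>x | mset x = tri_mset a m c \<and> x ! k = d. weight x) =
     real (count (tri_mset a m c) d) / real n * (real (n choose a) * real (n choose c))"
proof -
  let ?W = "{x. mset x = tri_mset a m c}"
  define F where "F k = (\<Sum>x\<in>?W. if x ! k = d then weight x else 0)" for k
  have len: "length x = n" if "x \<in> ?W" for x
    using that assms(3) by (metis (mono_tags) mem_Collect_eq size_mset size_tri_mset)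
  have two: "2 \<in> set x" if "x \<in> ?W" for x
    using that assms(1) by (auto simp: tri_mset_def simp flip: set_mset_mset)
  have "F (Suc k) = F k" if "Suc k < n" for k
  proof -
    have "F k = (\<Sum>x\<in>?W. if rotate1 x ! k = d then weight (rotate1 x) else 0)"
      unfolding F_def by (rule sum_rotate1[symmetric])
    also have "\<dots> = F (Suc k)"
      unfolding F_def
    proof (intro sum.cong refl)
      fix x assume x: "x \<in> ?W"
      then have "rotate1 x ! k = x ! Suc k" using len[OF x] that by (simp add: nth_rotate1)
      then show "(if rotate1 x ! k = d then weight (rotate1 x) else 0) =
          (if x ! Suc k = d then weight x else 0)"
        using weight_rotate1[OF two[OF x]] by simp
    qed
    finally show ?thesis by simp
  qed
  then have const: "F k = F 0" if "k < n" for k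
    using that by (induction k) auto
  have "(\<Sum>k<n. F k) = (\<Sum>k<n. F 0)" using const by (intro sum.cong) blast+
  then have "real n * F 0 = (\<Sum>k<n. F k)" by simp
  also have "\<dots> = (\<Sum>x\<in>?W. weight x * (\<Sum>k<n. if x ! k = d then 1 else 0))"
    unfolding F_def sum_distrib_left by (subst sum.swap) (auto intro!: sum.cong)
  also have "\<dots> = (\<Sum>x\<in>?W. weight x * real (count (tri_mset a m c) d))"
  proof (intro sum.cong refl)
    fix x assume x: "x \<in> ?W"
    then show "weight x * (\<Sum>k<n. if x ! k = d then 1 else 0) = weight x * real (count (tri_mset a m c) d)"
      using sum_of_bool_nth_eq[where x = x and d = d] len[OF x] by simp
  qed
  also have "\<dots> = real (count (tri_mset a m c) d) * (real (n choose a) * real (n choose c))"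
    using sum_weight[OF assms(1), of a c] assms(3) by (simp flip: sum_distrib_right)
  finally have "F k = real (count (tri_mset a m c) d) / real n * (real (n choose a) * real (n choose c))"
    using const[of k] assms by (simp add: field_simps)
  then show ?thesis
    using sum_if_Collect[OF finite_mset_eq[of "tri_mset a m c" "\<lambda>_. True", simplified]]
    by (simp add: F_def)
qed

lemma sum_Cons:
  fixes f :: "'a list \<Rightarrow> real"
  shows "(\<Sum>x | mset x = add_mset d M \<and> x ! 0 = d. f x) = (\<Sum>y | mset y = M. f (d # y))"
proof -
  have "{x. mset x = add_mset d M \<and> x ! 0 = d} = (#) d ` {y. mset y = M}"
  proof (intro set_eqI iffI)
    fix x assume "x \<in> {x. mset x = add_mset d M \<and> x ! 0 = d}"
    then show "x \<in> (#) d ` {y. mset y = M}" by (cases x) auto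
  qed auto
  then show ?thesis by (simp add: sum.reindex)
qed

lemma sum_Cons_Cons:
  fixes f :: "'a list \<Rightarrow> real"
  shows "(\<Sum>x | mset x = add_mset d (add_mset e M) \<and> x ! 0 = d \<and> x ! 1 = e. f x) =
     (\<Sum>y | mset y = M. f (d # e # y))"
proof -
  let ?W = "{x. mset x = add_mset d (add_mset e M) \<and> x ! 0 = d \<and> x ! 1 = e}"
  have "?W = (\<lambda>y. d # e # y) ` {y. mset y = M}"
  proof (intro set_eqI iffI)
    fix x assume x: "x \<in> ?W"
    then have "length x = Suc (Suc (size M))" by (metis (mono_tags) mem_Collect_eq size_add_mset size_mset)
    then obtain u v y where "x = u # v # y" by (auto simp: length_Suc_conv)
    then show "x \<in> (\<lambda>y. d # e # y) ` {y. mset y = M}" using x by auto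
  qed auto
  then show ?thesis by (simp add: sum.reindex inj_on_def)
qed

lemma tri_mset_Suc:
  "tri_mset (Suc a) m c = add_mset 1 (tri_mset a m c)"
  "tri_mset a (Suc m) c = add_mset 2 (tri_mset a m c)"
  "tri_mset a m (Suc c) = add_mset 3 (tri_mset a m c)"
  by (simp_all add: tri_mset_def)

lemma count_tri_mset [simp]:
  "count (tri_mset a m c) 1 = a" "count (tri_mset a m c) (Suc 0) = a"
  "count (tri_mset a m c) 2 = m" "count (tri_mset a m c) 3 = c"
  by (simp_all add: tri_mset_def)

text \<open>One-point functions of a ring with n + 1 sites, written with the first letter split off
  because the quadratic relations produce them in this shape.\<close>

lemma sum_weight_Cons:
  assumes "n = a + m + c"
  shows "m > 0 \<Longrightarrow> (\<Sum>y | mset y = tri_mset a m c. weight (1 # y)) =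
       real (Suc a) / real (Suc n) * (real (Suc n choose Suc a) * real (Suc n choose c))"
    and "(\<Sum>y | mset y = tri_mset a m c. weight (2 # y)) =
       real (Suc m) / real (Suc n) * (real (Suc n choose a) * real (Suc n choose c))"
    and "m > 0 \<Longrightarrow> (\<Sum>y | mset y = tri_mset a m c. weight (3 # y)) =
       real (Suc c) / real (Suc n) * (real (Suc n choose a) * real (Suc n choose Suc c))"
proof -
  assume "m > 0"
  then show "(\<Sum>y | mset y = tri_mset a m c. weight (1 # y)) =
       real (Suc a) / real (Suc n) * (real (Suc n choose Suc a) * real (Suc n choose c))"
    using sum_weight_nth[of m 0 "Suc a" c "Suc n" 1] assms
    unfolding sum_Cons[symmetric] tri_mset_Suc(1)[symmetric] count_tri_mset by simp
next
  show "(\<Sum>y | mset y = tri_mset a m c. weight (2 # y)) =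
       real (Suc m) / real (Suc n) * (real (Suc n choose a) * real (Suc n choose c))"
    using sum_weight_nth[of "Suc m" 0 a c "Suc n" 2] assms
    unfolding sum_Cons[symmetric] tri_mset_Suc(2)[symmetric] count_tri_mset by simp
next
  assume "m > 0"
  then show "(\<Sum>y | mset y = tri_mset a m c. weight (3 # y)) =
       real (Suc c) / real (Suc n) * (real (Suc n choose a) * real (Suc n choose Suc c))"
    using sum_weight_nth[of m 0 a "Suc c" "Suc n" 3] assms
    unfolding sum_Cons[symmetric] tri_mset_Suc(3)[symmetric] count_tri_mset by simp
qed

text \<open>Turns the partition functions of the shortened ring into rational multiples of those for
  n sites.\<close>

lemma binomial_pred_real:
  assumes "n > 0"
  shows "real (n - 1 choose k) = (real n - real k) / real n * real (n choose k)"
    and "k > 0 \<Longrightarrow> real (n - 1 choose (k - 1)) = real k / real n * real (n choose k)"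
proof -
  show "real (n - 1 choose k) = (real n - real k) / real n * real (n choose k)"
  proof (cases "k \<le> n")
    case True
    have "real ((n - k) * (n choose k)) = real (n * (n - 1 choose k))"
      using binomial_absorb_comp[of n k] by simp
    then show ?thesis using True assms by (simp add: of_nat_diff field_simps)
  qed (simp add: binomial_eq_0)
  assume "k > 0"
  then have "real (k * (n choose k)) = real (n * (n - 1 choose (k - 1)))"
    using binomial_absorption[of "k - 1" n] by simp
  then show "real (n - 1 choose (k - 1)) = real k / real n * real (n choose k)"
    using assms by (simp add: field_simps)
qed

lemma sum_weight_31:
  assumes "a > 0" "m > 0" "c > 0" "n = a + m + c"
  shows "(\<Sum>x | mset x = tri_mset a m c \<and> x ! 0 = 3 \<and> x ! 1 = 1. weight x) =
     real a * real c * (2 * real n - real a - real c) / ((real n)\<^sup>2 * (real n - 1)) *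
       (real (n choose a) * real (n choose c))"
proof -
  obtain a' c' where a': "a = Suc a'" "c = Suc c'" using assms by (metis Suc_pred)
  define k where "k = a' + m + c'"
  have n: "n = Suc (Suc k)" using assms a' by (simp add: k_def)
  have n0: "n > 0" using n by simp
  have two: "2 \<in> set y" if "mset y = tri_mset a' m c'" for y
    using that assms(2) by (auto simp: tri_mset_def simp flip: set_mset_mset)
  have "tri_mset a m c = add_mset 3 (add_mset 1 (tri_mset a' m c'))"
    by (simp add: a' tri_mset_Suc)
  then have "(\<Sum>x | mset x = tri_mset a m c \<and> x ! 0 = 3 \<and> x ! 1 = 1. weight x) =
      (\<Sum>y | mset y = tri_mset a' m c'. weight (3 # 1 # y))"
    using sum_Cons_Cons[where d = 3 and e = 1 and M = "tri_mset a' m c'" and f = weight] by simp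
  also have "\<dots> = (\<Sum>y | mset y = tri_mset a' m c'. weight (3 # y)) +
      (\<Sum>y | mset y = tri_mset a' m c'. weight (1 # y))"
    unfolding sum.distrib[symmetric] using two by (intro sum.cong) (auto simp only: weight_31)
  \<comment> \<open>On the ring with n - 1 sites the first sum has a - 1 letters 1 and c letters 3,
    the second a and c - 1.\<close>
  also have "\<dots> = real c / real (n - 1) * (real (n - 1 choose (a - 1)) * real (n - 1 choose c)) +
      real a / real (n - 1) * (real (n - 1 choose a) * real (n - 1 choose (c - 1)))"
    using sum_weight_Cons(1,3)[of k a' m c'] assms(2) n by (simp add: k_def a')
  also have "\<dots> = real c / real (n - 1) *
        ((real a / real n * real (n choose a)) * ((real n - real c) / real n * real (n choose c))) +
      real a / real (n - 1) *
        (((real n - real a) / real n * real (n choose a)) * (real c / real n * real (n choose c)))"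
    by (simp only: binomial_pred_real(1)[OF n0, of a] binomial_pred_real(1)[OF n0, of c]
        binomial_pred_real(2)[OF n0 assms(1)] binomial_pred_real(2)[OF n0 assms(3)])
  also have "\<dots> = real a * real c * (2 * real n - real a - real c) / ((real n)\<^sup>2 * (real n - 1)) *
       (real (n choose a) * real (n choose c))"
  proof -
    have *: "C / D * ((A / N * X) * ((N - C) / N * Y)) + A / D * (((N - A) / N * X) * (C / N * Y)) =
        A * C * (2 * N - A - C) / (N\<^sup>2 * D) * (X * Y)"
      if "N \<noteq> 0" "D \<noteq> 0" for A C D N X Y :: real
      using that by (simp add: field_simps power2_eq_square)
    have "real (n - 1) = real n - 1" "real n \<noteq> 0" "real n - 1 \<noteq> 0" using n by auto
    then show ?thesis by (metis *)
  qed
  finally show ?thesis .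
qed

lemma sum_weight_13:
  assumes "a > 0" "m > 0" "c > 0" "n = a + m + c"
  shows "(\<Sum>x | mset x = tri_mset a m c \<and> x ! 0 = 1 \<and> x ! 1 = 3. weight x) =
     real a * real c / (real n)\<^sup>2 * (real (n choose a) * real (n choose c))"
proof -
  obtain a' c' where a': "a = Suc a'" "c = Suc c'" using assms by (metis Suc_pred)
  define k where "k = a' + m + c'"
  have n: "n = Suc (Suc k)" using assms a' by (simp add: k_def)
  have n0: "n > 0" using n by simp
  have two: "2 \<in> set y" if "mset y = tri_mset a' m c'" for y
    using that assms(2) by (auto simp: tri_mset_def simp flip: set_mset_mset)
  have M: "tri_mset a m c = add_mset 1 (add_mset 3 (tri_mset a' m c'))"
    "tri_mset a m c = add_mset 3 (add_mset 1 (tri_mset a' m c'))"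
    by (simp_all add: a' tri_mset_Suc add_mset_commute)
  have "(\<Sum>x | mset x = tri_mset a m c \<and> x ! 0 = 1 \<and> x ! 1 = 3. weight x) =
      (\<Sum>y | mset y = tri_mset a' m c'. weight (1 # 3 # y))"
    unfolding M(1) by (rule sum_Cons_Cons)
  also have "\<dots> = (\<Sum>y | mset y = tri_mset a' m c'. weight (3 # 1 # y)) -
      (\<Sum>y | mset y = tri_mset a' m c'. weight (2 # y))"
    unfolding sum_subtractf[symmetric] using two by (intro sum.cong) (auto simp only: weight_13)
  also have "(\<Sum>y | mset y = tri_mset a' m c'. weight (3 # 1 # y)) =
      (\<Sum>x | mset x = tri_mset a m c \<and> x ! 0 = 3 \<and> x ! 1 = 1. weight x)"
    unfolding M(2) by (rule sum_Cons_Cons[symmetric])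
  also note sum_weight_31[OF assms]
  also have "(\<Sum>y | mset y = tri_mset a' m c'. weight (2 # y)) =
      real (Suc m) / real (n - 1) * (real (n - 1 choose (a - 1)) * real (n - 1 choose (c - 1)))"
    using sum_weight_Cons(2)[of k a' m c'] n by (simp add: k_def a')
  also have "\<dots> = real (Suc m) / real (n - 1) *
      ((real a / real n * real (n choose a)) * (real c / real n * real (n choose c)))"
    by (simp only: binomial_pred_real(1)[OF n0, of a] binomial_pred_real(1)[OF n0, of c]
        binomial_pred_real(2)[OF n0 assms(1)] binomial_pred_real(2)[OF n0 assms(3)])
  also have "real a * real c * (2 * real n - real a - real c) / ((real n)\<^sup>2 * (real n - 1)) *
      (real (n choose a) * real (n choose c)) - \<dots> =
      real a * real c / (real n)\<^sup>2 * (real (n choose a) * real (n choose c))"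
  proof -
    \<comment> \<open>Here E stands for 2n - a - c = n + m and D for n - 1, so the number m + 1 of
      letters 2 is E - D. The difference of E / D and (E - D) / D is 1, which removes the
      denominator n - 1.\<close>
    have *: "A * C * E / (N\<^sup>2 * D) * (X * Y) - (E - D) / D * ((A / N * X) * (C / N * Y)) =
        A * C / N\<^sup>2 * (X * Y)"
      if "N \<noteq> 0" "D \<noteq> 0" for A C D E N X Y :: real
      using that by (simp add: field_simps power2_eq_square)
    have "real (n - 1) = real n - 1" "real n \<noteq> 0" "real n - 1 \<noteq> 0"
      "real (Suc m) = (2 * real n - real a - real c) - (real n - 1)" using n assms by auto
    then show ?thesis by (metis *)
  qed
  finally show ?thesis .
qed

text \<open>The two-letter case for equal thresholds, where 2 stands for the upper class.\<close>

lemma sum_weight_21: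
  assumes "a > 0" "m > 0" "n = a + m"
  shows "(\<Sum>x | mset x = tri_mset a m 0 \<and> x ! 0 = 2 \<and> x ! 1 = 1. weight x) =
     real a * real m / (real n * (real n - 1)) * real (n choose a)"
proof -
  obtain a' m' where a': "a = Suc a'" "m = Suc m'" using assms by (metis Suc_pred)
  define k where "k = a' + m'"
  have n: "n = Suc (Suc k)" using assms a' by (simp add: k_def)
  have n0: "n > 0" using n by simp
  have "tri_mset a m 0 = add_mset 2 (add_mset 1 (tri_mset a' m' 0))"
    by (simp add: a' tri_mset_Suc)
  then have "(\<Sum>x | mset x = tri_mset a m 0 \<and> x ! 0 = 2 \<and> x ! 1 = 1. weight x) =
      (\<Sum>y | mset y = tri_mset a' m' 0. weight (2 # 1 # y))"
    using sum_Cons_Cons[where d = 2 and e = 1 and M = "tri_mset a' m' 0" and f = weight] by simp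
  also have "\<dots> = real m / real (n - 1) * real (n - 1 choose (a - 1))"
    using sum_weight_Cons(2)[of k a' m' 0] n by (simp add: k_def a' weight_21[simplified])
  also have "\<dots> = real m / real (n - 1) * (real a / real n * real (n choose a))"
    by (simp only: binomial_pred_real(2)[OF n0 assms(1)])
  also have "\<dots> = real a * real m / (real n * (real n - 1)) * real (n choose a)"
    using n0 by (simp add: of_nat_diff mult_ac)
  finally show ?thesis .
qed

subsection \<open>Projection to three classes\<close>

lemma tasep_states_iff: "u \<in> tasep_states n \<longleftrightarrow> mset u = mset_set {1..n}"
proof -
  have "u \<in> tasep_states n \<longleftrightarrow> set u = {1..n} \<and> distinct u"
    by (auto simp: tasep_states_def permutations_of_set_def)
  also have "\<dots> \<longleftrightarrow> mset u = mset_set {1..n}"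
    by (metis finite_atLeastAtMost finite_set_mset_mset_set mset_set_set set_mset_mset
        mset_eq_mset_set_imp_distinct)
  finally show ?thesis .
qed

text \<open>Row u of the generator applied to f is the sum over the n clocks of the change of f; the
  balance equations are then summed against f.\<close>

lemma stationary_invariant:
  assumes "stationary_distribution (tasep_states n) tasep_rate \<pi>"
  shows "invariant n (tasep_states n) (pmf \<pi>)"
  unfolding invariant_def
proof
  fix f :: "nat list \<Rightarrow> real"
  let ?S = "tasep_states n" and ?G = "ctmc_generator (tasep_states n) tasep_rate"
  have fin: "finite ?S" by (simp add: tasep_states_def)
  have len: "length u = n" if "u \<in> ?S" for u
    using that by (metis card_atLeastAtMost diff_Suc_1 size_mset size_mset_set tasep_states_iff)
  have ring: "tasep_ring u m \<in> ?S" if "u \<in> ?S" "m < n" for u m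
    using that len[OF that(1)] by (simp add: tasep_states_iff mset_tasep_ring)
  have row: "(\<Sum>v\<in>?S. ?G u v * f v) = (\<Sum>m<n. f (tasep_ring u m)) - real n * f u" if u: "u \<in> ?S" for u
  proof -
    have "(\<Sum>v\<in>?S. ?G u v * f v) = ?G u u * f u + (\<Sum>v\<in>?S - {u}. ?G u v * f v)"
      by (rule sum.remove[OF fin u])
    also have "(\<Sum>v\<in>?S - {u}. ?G u v * f v) = (\<Sum>v\<in>?S - {u}. tasep_rate u v * f v)"
      by (intro sum.cong) (auto simp: ctmc_generator_def)
    also have "?G u u * f u = - (\<Sum>v\<in>?S - {u}. tasep_rate u v * f u)"
      by (simp add: ctmc_generator_def sum_distrib_right)
    finally have "(\<Sum>v\<in>?S. ?G u v * f v) = (\<Sum>v\<in>?S - {u}. tasep_rate u v * (f v - f u))"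
      by (simp add: right_diff_distrib sum_subtractf)
    \<comment> \<open>The diagonal term is multiplied by f u - f u, so rings that change nothing may
      be counted as well.\<close>
    also have "\<dots> = (\<Sum>v\<in>?S. tasep_rate u v * (f v - f u))"
      by (subst sum.remove[OF fin u]) simp
    also have "\<dots> = (\<Sum>v\<in>?S. \<Sum>m\<in>{m \<in> {..<n}. tasep_ring u m = v}. f (tasep_ring u m) - f u)"
      using len[OF u] by (intro sum.cong) (auto simp: tasep_rate_def)
    also have "\<dots> = (\<Sum>m<n. f (tasep_ring u m) - f u)"
      using ring[OF u] by (intro sum.group fin) auto
    finally show ?thesis by (simp add: sum_subtractf)
  qed
  have "0 = (\<Sum>v\<in>?S. (\<Sum>u\<in>?S. pmf \<pi> u * ?G u v) * f v)"
    using assms by (simp add: stationary_distribution_def)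
  also have "\<dots> = (\<Sum>v\<in>?S. \<Sum>u\<in>?S. pmf \<pi> u * (?G u v * f v))"
    by (simp add: sum_distrib_right mult.assoc)
  also have "\<dots> = (\<Sum>u\<in>?S. pmf \<pi> u * (\<Sum>v\<in>?S. ?G u v * f v))"
    by (subst sum.swap) (simp add: sum_distrib_left)
  also have "\<dots> = (\<Sum>u\<in>?S. pmf \<pi> u * ((\<Sum>m<n. f (tasep_ring u m)) - real n * f u))"
    using row by (intro sum.cong) auto
  also have "\<dots> = (\<Sum>u\<in>?S. pmf \<pi> u * (\<Sum>m<n. f (tasep_ring u m))) - real n * (\<Sum>u\<in>?S. pmf \<pi> u * f u)"
    by (simp add: right_diff_distrib sum_subtractf sum_distrib_left mult.left_commute)
  finally show "(\<Sum>u\<in>?S. pmf \<pi> u * (\<Sum>m<n. f (tasep_ring u m))) = real n * (\<Sum>u\<in>?S. pmf \<pi> u * f u)"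
    by simp
qed

lemma sum_projection:
  fixes p h :: "_ \<Rightarrow> real"
  assumes "finite S" "finite T" "map g ` S \<subseteq> T"
  shows "(\<Sum>x\<in>T. (\<Sum>u\<in>{u \<in> S. map g u = x}. p u) * h x) = (\<Sum>u\<in>S. p u * h (map g u))"
proof -
  have "(\<Sum>x\<in>T. (\<Sum>u\<in>{u \<in> S. map g u = x}. p u) * h x) =
      (\<Sum>x\<in>T. \<Sum>u\<in>{u \<in> S. map g u = x}. p u * h (map g u))"
    by (simp add: sum_distrib_right)
  also have "\<dots> = (\<Sum>u\<in>S. p u * h (map g u))"
    by (rule sum.group[OF assms])
  finally show ?thesis .
qed

lemma invariant_projection:
  assumes "mono g" "finite S" "finite T" "map g ` S \<subseteq> T" "\<And>u. u \<in> S \<Longrightarrow> length u = n"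
    and "invariant n S p"
  shows "invariant n T (\<lambda>x. \<Sum>u\<in>{u \<in> S. map g u = x}. p u)"
  unfolding invariant_def
proof
  fix f :: "nat list \<Rightarrow> real"
  have "(\<Sum>u\<in>S. p u * (\<Sum>m<n. f (tasep_ring (map g u) m))) =
      (\<Sum>u\<in>S. p u * (\<Sum>m<n. f (map g (tasep_ring u m))))"
    using assms(1,5) by (intro sum.cong refl arg_cong2[of _ _ _ _ "(*)"]) (auto simp: map_tasep_ring)
  also have "\<dots> = real n * (\<Sum>u\<in>S. p u * f (map g u))"
    using assms(6)[unfolded invariant_def, rule_format, of "\<lambda>u. f (map g u)"] .
  finally show "(\<Sum>x\<in>T. (\<Sum>u\<in>{u \<in> S. map g u = x}. p u) * (\<Sum>m<n. f (tasep_ring x m))) =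
     real n * (\<Sum>x\<in>T. (\<Sum>u\<in>{u \<in> S. map g u = x}. p u) * f x)"
    unfolding sum_projection[OF assms(2-4)] .
qed

definition species_class :: "nat \<Rightarrow> nat \<Rightarrow> nat \<Rightarrow> nat" where
  "species_class a b v = (if v \<le> a then 1 else if v \<le> b then 2 else 3)"

lemma mono_species_class: "a \<le> b \<Longrightarrow> mono (species_class a b)"
  by (auto simp: species_class_def intro!: monoI)

lemma image_mset_species_class:
  assumes "a \<le> b" "b \<le> n"
  shows "image_mset (species_class a b) (mset_set {1..n}) = tri_mset a (b - a) (n - b)"
proof -
  have "mset_set {1..n} = mset_set {1..a} + mset_set {a<..b} + mset_set {b<..n}"
  proof -
    have "{1..n} = {1..a} \<union> {a<..b} \<union> {b<..n}" using assms by auto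
    moreover have "{1..a} \<inter> {a<..b} = {}" "({1..a} \<union> {a<..b}) \<inter> {b<..n} = {}" using assms by auto
    ultimately show ?thesis by (simp add: mset_set_Union)
  qed
  moreover have "image_mset (species_class a b) (mset_set A) = replicate_mset (card A) d"
    if "finite A" "\<And>x. x \<in> A \<Longrightarrow> species_class a b x = d" for A d
  proof -
    have "image_mset (species_class a b) (mset_set A) = image_mset (\<lambda>_. d) (mset_set A)"
      using that by (intro image_mset_cong) simp
    then show ?thesis by (simp add: image_mset_const_eq)
  qed
  from this[of "{1..a}" 1] this[of "{a<..b}" 2] this[of "{b<..n}" 3]
  have "image_mset (species_class a b) (mset_set {1..a}) = replicate_mset a 1"
    "image_mset (species_class a b) (mset_set {a<..b}) = replicate_mset (b - a) 2"
    "image_mset (species_class a b) (mset_set {b<..n}) = replicate_mset (n - b) 3"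
    using assms by (simp_all add: species_class_def)
  ultimately show ?thesis by (simp add: tri_mset_def)
qed

text \<open>The image of \<open>\<pi>\<close> under the class map is invariant, hence a multiple of
  \<open>weight\<close>. Total mass 1 and the partition function fix the factor.\<close>

lemma prob_eq_sum_weight:
  assumes n: "n \<ge> 2" and st: "stationary_distribution (tasep_states n) tasep_rate \<pi>"
    and ab: "a < b" "b \<le> n"
    and Q: "\<And>u. mset u = mset_set {1..n} \<Longrightarrow> length u = n \<Longrightarrow> Q u \<longleftrightarrow> P (map (species_class a b) u)"
  shows "measure_pmf.prob \<pi> {w. Q w} =
     (\<Sum>x | mset x = tri_mset a (b - a) (n - b) \<and> P x. weight x) /
       (real (n choose a) * real (n choose (n - b)))"
proof -
  let ?S = "tasep_states n" and ?g = "species_class a b"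
  define M where "M = tri_mset a (b - a) (n - b)"
  define T where "T = permutations_of_multiset M"
  define q where "q x = (\<Sum>u\<in>{u \<in> ?S. map ?g u = x}. pmf \<pi> u)" for x
  have T_eq: "T = {x. mset x = M}" by (simp add: T_def permutations_of_multiset_def)
  have finS: "finite ?S" by (simp add: tasep_states_def)
  have finT: "finite T" by (simp add: T_def)
  have len: "length u = n" if "u \<in> ?S" for u
    using that by (metis card_atLeastAtMost diff_Suc_1 size_mset size_mset_set tasep_states_iff)
  have size: "size M = n" using ab by (simp add: M_def)
  have M: "set_mset M \<subseteq> {1,2,3}" "2 \<in># M" using ab by (auto simp: M_def tri_mset_def split: if_splits)
  have sub: "map ?g ` ?S \<subseteq> T"
    using image_mset_species_class[of a b n] ab by (auto simp: T_eq M_def tasep_states_iff)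
  have pos: "weight x > 0" if "x \<in> T" for x
    using that n size by (intro weight_pos) (auto simp: T_eq)
  have "invariant n T q"
    unfolding q_def using ab
    by (intro invariant_projection mono_species_class finS finT sub len stationary_invariant[OF st]) auto
  then obtain C where C: "\<And>x. x \<in> T \<Longrightarrow> q x = C * weight x"
    using invariant_unique[OF T_def size n invariant_weight[OF T_def M size n] pos] by blast
  have supp: "set_pmf \<pi> \<subseteq> ?S" using st by (simp add: stationary_distribution_def)
  have prob: "measure_pmf.prob \<pi> {w. R w} = C * (\<Sum>x | mset x = M \<and> P' x. weight x)"
    if R: "\<And>u. u \<in> ?S \<Longrightarrow> R u \<longleftrightarrow> P' (map ?g u)" for R P'
  proof -
    have "measure_pmf.prob \<pi> {w. R w} = measure_pmf.prob \<pi> {w \<in> ?S. R w}"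
    proof -
      have "{w. R w} \<inter> set_pmf \<pi> = {w \<in> ?S. R w} \<inter> set_pmf \<pi>" using supp by auto
      then show ?thesis by (metis measure_Int_set_pmf)
    qed
    also have "\<dots> = (\<Sum>u\<in>{w \<in> ?S. R w}. pmf \<pi> u)"
      using finS by (intro measure_measure_pmf_finite) auto
    also have "\<dots> = (\<Sum>u\<in>?S. pmf \<pi> u * (if P' (map ?g u) then 1 else 0))"
      using finS R by (auto simp: sum.inter_filter intro!: sum.cong)
    also have "\<dots> = (\<Sum>x\<in>T. q x * (if P' x then 1 else 0))"
      unfolding q_def by (rule sum_projection[OF finS finT sub, symmetric])
    also have "\<dots> = (\<Sum>x\<in>T. C * (if P' x then weight x else 0))"
      using C by (intro sum.cong) auto
    also have "\<dots> = C * (\<Sum>x | mset x = M \<and> P' x. weight x)"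
      using sum_if_Collect[where P = "\<lambda>x. mset x = M" and Q = P' and f = weight] finT T_eq by (simp add: sum_distrib_left)
    finally show ?thesis .
  qed
  have Z: "(\<Sum>x | mset x = M. weight x) = real (n choose a) * real (n choose (n - b))"
    using sum_weight[of "b - a" a "n - b"] ab by (simp add: M_def)
  have "C * (real (n choose a) * real (n choose (n - b))) = 1"
    using prob[of "\<lambda>_. True" "\<lambda>_. True"] Z by simp
  moreover have "real (n choose a) * real (n choose (n - b)) \<noteq> 0" using ab by auto
  ultimately have "C = 1 / (real (n choose a) * real (n choose (n - b)))"
    by (simp add: eq_divide_eq)
  then show ?thesis
    using prob[of Q P] Q len by (simp add: tasep_states_iff M_def)
qed

subsection \<open>Two-point probabilities\<close>

lemma species_class_eq:
  assumes "a \<le> b"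
  shows "species_class a b v = 1 \<longleftrightarrow> v \<le> a" "species_class a b v = Suc 0 \<longleftrightarrow> v \<le> a"
    "species_class a b v = 2 \<longleftrightarrow> a < v \<and> v \<le> b" "species_class a b v = 3 \<longleftrightarrow> b < v"
  using assms by (auto simp: species_class_def)

lemma binomial_ne_0: "k \<le> n \<Longrightarrow> real (n choose k) \<noteq> 0"
  by simp

section \<open>Threshold probabilities of descents and ascents\<close>

context
  fixes n :: nat and \<pi> :: "nat list pmf"
  assumes n: "n \<ge> 2" and st: "stationary_distribution (tasep_states n) tasep_rate \<pi>"
begin

lemma prob_eq_0:
  assumes "\<And>u. set u = {1..n} \<Longrightarrow> length u = n \<Longrightarrow> \<not> Q u"
  shows "measure_pmf.prob \<pi> {w. Q w} = 0"
proof -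
  have "\<not> Q u" if "mset u = mset_set {1..n}" "length u = n" for u
    using assms[of u] that by (metis finite_atLeastAtMost finite_set_mset_mset_set set_mset_mset)
  then show ?thesis
    \<comment> \<open>Any admissible thresholds would do, since the sum over the predicate False is
      empty.\<close>
    using prob_eq_sum_weight[OF n st, of 0 n Q "\<lambda>_. False"] n by simp
qed

text \<open>The diagonal is computed separately but fits the same formula: for a = b the factor n +
  b - a equals n and cancels against the denominator.\<close>

lemma prob_descent_threshold:
  assumes ab: "a \<le> b" "b \<le> n"
  shows "measure_pmf.prob \<pi> {w. b < w ! 0 \<and> w ! 1 \<le> a} =
     real a * (real n - real b) * (real n + real b - real a) / ((real n)\<^sup>2 * (real n - 1))"
proof (cases "a = 0 \<or> b = n")
  case True
  have "\<not> (b < u ! 0 \<and> u ! 1 \<le> a)" if "set u = {1..n}" "length u = n" for u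
  proof -
    have "u ! 0 \<in> {1..n}" "u ! 1 \<in> {1..n}"
      unfolding that(1)[symmetric] using n that(2) by (auto intro!: nth_mem)
    then show ?thesis using True by auto
  qed
  then show ?thesis using True prob_eq_0 by auto
next
  case False
  then have a: "a > 0" "b < n" using ab by auto
  show ?thesis
  proof (cases "a < b")
    case True
    have "measure_pmf.prob \<pi> {w. b < w ! 0 \<and> w ! 1 \<le> a} =
      (\<Sum>x | mset x = tri_mset a (b - a) (n - b) \<and> x ! 0 = 3 \<and> x ! 1 = 1. weight x) /
        (real (n choose a) * real (n choose (n - b)))"
      by (rule prob_eq_sum_weight[OF n st True ab(2)]) (use n ab in \<open>auto simp: species_class_eq\<close>)
    also have "\<dots> = real a * real (n - b) * (2 * real n - real a - real (n - b)) / ((real n)\<^sup>2 * (real n - 1))"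
      using sum_weight_31[of a "b - a" "n - b" n] True a ab binomial_ne_0[of a n] binomial_ne_0[of "n - b" n]
      by simp
    also have "\<dots> = real a * (real n - real b) * (real n + real b - real a) / ((real n)\<^sup>2 * (real n - 1))"
      using ab by (simp add: of_nat_diff add_ac)
    finally show ?thesis .
  next
    case False
    \<comment> \<open>The thresholds a and n label the upper class 2 and leave no letter 3.\<close>
    then have b: "b = a" using ab by simp
    have "measure_pmf.prob \<pi> {w. b < w ! 0 \<and> w ! 1 \<le> a} =
      (\<Sum>x | mset x = tri_mset a (n - a) (n - n) \<and> x ! 0 = 2 \<and> x ! 1 = 1. weight x) /
        (real (n choose a) * real (n choose (n - n)))"
    proof (rule prob_eq_sum_weight[OF n st])
      fix u assume u: "mset u = mset_set {1..n}" "length u = n"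
      have "u ! 0 \<in># mset_set {1..n}" unfolding u(1)[symmetric] using u(2) n by (auto intro!: nth_mem)
      then show "(b < u ! 0 \<and> u ! 1 \<le> a) \<longleftrightarrow>
          (map (species_class a n) u ! 0 = 2 \<and> map (species_class a n) u ! 1 = 1)"
        using n u(2) a b by (auto simp: species_class_eq)
    qed (use a b in auto)
    also have "\<dots> = real a * real (n - a) / (real n * (real n - 1))"
      using sum_weight_21[of a "n - a" n] a b binomial_ne_0[of a n] by simp
    also have "\<dots> = real a * (real n - real b) * (real n + real b - real a) / ((real n)\<^sup>2 * (real n - 1))"
      using a b by (simp add: of_nat_diff power2_eq_square)
    finally show ?thesis .
  qed
qed

lemma prob_site_le:
  assumes "k < n" "0 < a" "a < n"
  shows "measure_pmf.prob \<pi> {w. w ! k \<le> a} = real a / real n"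
proof -
  have "measure_pmf.prob \<pi> {w. w ! k \<le> a} =
      (\<Sum>x | mset x = tri_mset a (n - a) (n - n) \<and> x ! k = 1. weight x) /
        (real (n choose a) * real (n choose (n - n)))"
    using assms by (intro prob_eq_sum_weight[OF n st]) (auto simp: species_class_eq)
  then show ?thesis
    using sum_weight_nth[of "n - a" k a 0 n 1] assms binomial_ne_0[of a n] by simp
qed

text \<open>For a = b the ascent is as likely as the descent: joined with the event that both sites
  are at most a, they give the events that the left site, respectively the right site, is at most a,
  and these have equal probability.\<close>

lemma prob_ascent_threshold:
  assumes ab: "a \<le> b" "b \<le> n"
  shows "measure_pmf.prob \<pi> {w. b < w ! 1 \<and> w ! 0 \<le> a} =
     (if a < b then real a * (real n - real b) / (real n)\<^sup>2
      else real a * (real n - real a) / (real n * (real n - 1)))"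
proof (cases "a = 0 \<or> b = n")
  case True
  have "\<not> (b < u ! 1 \<and> u ! 0 \<le> a)" if "set u = {1..n}" "length u = n" for u
  proof -
    have "u ! 0 \<in> {1..n}" "u ! 1 \<in> {1..n}"
      unfolding that(1)[symmetric] using n that(2) by (auto intro!: nth_mem)
    then show ?thesis using True by auto
  qed
  then show ?thesis using True ab prob_eq_0 by auto
next
  case False
  then have a: "a > 0" "b < n" using ab by auto
  show ?thesis
  proof (cases "a < b")
    case True
    have "measure_pmf.prob \<pi> {w. b < w ! 1 \<and> w ! 0 \<le> a} =
      (\<Sum>x | mset x = tri_mset a (b - a) (n - b) \<and> x ! 0 = 1 \<and> x ! 1 = 3. weight x) /
        (real (n choose a) * real (n choose (n - b)))"
      by (rule prob_eq_sum_weight[OF n st True ab(2)]) (use n ab in \<open>auto simp: species_class_eq\<close>)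
    also have "\<dots> = real a * real (n - b) / (real n)\<^sup>2"
      using sum_weight_13[of a "b - a" "n - b" n] True a ab binomial_ne_0[of a n] binomial_ne_0[of "n - b" n]
      by simp
    finally show ?thesis using True ab by (simp add: of_nat_diff)
  next
    case False
    then have b: "b = a" using ab by simp
    let ?B = "{w. w ! 0 \<le> a \<and> w ! 1 \<le> a}"
    have "measure_pmf.prob \<pi> ({w. b < w ! 1 \<and> w ! 0 \<le> a} \<union> ?B) =
        measure_pmf.prob \<pi> {w. b < w ! 1 \<and> w ! 0 \<le> a} + measure_pmf.prob \<pi> ?B"
      by (rule measure_pmf.finite_measure_Union) (use b in auto)
    moreover have "{w. b < w ! 1 \<and> w ! 0 \<le> a} \<union> ?B = {w. w ! 0 \<le> a}" using b by auto
    moreover have "measure_pmf.prob \<pi> ({w. b < w ! 0 \<and> w ! 1 \<le> a} \<union> ?B) =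
        measure_pmf.prob \<pi> {w. b < w ! 0 \<and> w ! 1 \<le> a} + measure_pmf.prob \<pi> ?B"
      by (rule measure_pmf.finite_measure_Union) (use b in auto)
    moreover have "{w. b < w ! 0 \<and> w ! 1 \<le> a} \<union> ?B = {w. w ! 1 \<le> a}" using b by auto
    moreover have "measure_pmf.prob \<pi> {w. w ! 0 \<le> a} = measure_pmf.prob \<pi> {w. w ! 1 \<le> a}"
      using prob_site_le[of 0 a] prob_site_le[of 1 a] a b n by simp
    ultimately have "measure_pmf.prob \<pi> {w. b < w ! 1 \<and> w ! 0 \<le> a} =
        measure_pmf.prob \<pi> {w. b < w ! 0 \<and> w ! 1 \<le> a}"
      by simp
    then show ?thesis using prob_descent_threshold[OF ab] b n by (simp add: power2_eq_square)
  qed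
qed

end

text \<open>\<open>X\<close> and \<open>Y\<close> are arbitrary so that one second difference serves
  descents, with \<open>X\<close> the left site, and ascents, with \<open>X\<close> the right
  site.\<close>

lemma prob_eq_threshold_differences:
  fixes X Y :: "'s \<Rightarrow> nat"
  assumes "i > 0" "j > 0"
  shows "measure_pmf.prob \<pi> {w. X w = j \<and> Y w = i} =
     measure_pmf.prob \<pi> {w. j - 1 < X w \<and> Y w \<le> i} - measure_pmf.prob \<pi> {w. j < X w \<and> Y w \<le> i}
     - measure_pmf.prob \<pi> {w. j - 1 < X w \<and> Y w \<le> i - 1}
     + measure_pmf.prob \<pi> {w. j < X w \<and> Y w \<le> i - 1}"
proof -
  have row: "measure_pmf.prob \<pi> {w. X w = j \<and> Y w \<le> k} =
     measure_pmf.prob \<pi> {w. j - 1 < X w \<and> Y w \<le> k} - measure_pmf.prob \<pi> {w. j < X w \<and> Y w \<le> k}" for k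
  proof -
    have "measure_pmf.prob \<pi> ({w. X w = j \<and> Y w \<le> k} \<union> {w. j < X w \<and> Y w \<le> k}) =
        measure_pmf.prob \<pi> {w. X w = j \<and> Y w \<le> k} + measure_pmf.prob \<pi> {w. j < X w \<and> Y w \<le> k}"
      by (rule measure_pmf.finite_measure_Union) auto
    moreover have "{w. X w = j \<and> Y w \<le> k} \<union> {w. j < X w \<and> Y w \<le> k} = {w. j - 1 < X w \<and> Y w \<le> k}"
      using assms by auto
    ultimately show ?thesis by simp
  qed
  have "measure_pmf.prob \<pi> ({w. X w = j \<and> Y w = i} \<union> {w. X w = j \<and> Y w \<le> i - 1}) =
      measure_pmf.prob \<pi> {w. X w = j \<and> Y w = i} + measure_pmf.prob \<pi> {w. X w = j \<and> Y w \<le> i - 1}"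
    by (rule measure_pmf.finite_measure_Union) (use assms in auto)
  moreover have "{w. X w = j \<and> Y w = i} \<union> {w. X w = j \<and> Y w \<le> i - 1} = {w. X w = j \<and> Y w \<le> i}"
    using assms by auto
  ultimately show ?thesis using row[of i] row[of "i - 1"] by simp
qed

theorem theorem4p2:
  fixes n i j :: nat and \<pi> :: "nat list pmf"
  assumes "n \<ge> 2"
    and "stationary_distribution (tasep_states n) tasep_rate \<pi>"
    and "1 \<le> i" and "i < j" and "j \<le> n"
  shows "measure_pmf.prob \<pi> {w. w ! 0 = j \<and> w ! 1 = i}
           = (real j - real i) / (real n * real (n choose 2))
       \<and> measure_pmf.prob \<pi> {w. w ! 0 = i \<and> w ! 1 = j}
           = (if i = j - 1
              then 1 / (real n)\<^sup>2 + real i * (real n - real i) / ((real n)\<^sup>2 * (real n - 1))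
              else 1 / (real n)\<^sup>2)"
proof
  have pos: "i > 0" "j > 0" and le: "i \<le> j - 1" "i - 1 < j - 1" "i - 1 < j" "j - 1 \<le> n" using assms by auto
  have real: "real (i - 1) = real i - 1" "real (j - 1) = real j - 1" using pos by auto
  have n: "real n \<noteq> 0" "real n - 1 \<noteq> 0" using assms(1) by auto
  have le': "i \<le> j" "i - 1 \<le> j - 1" "i - 1 \<le> j" using le assms by auto
  note D = prob_descent_threshold[OF assms(1,2)] and U = prob_ascent_threshold[OF assms(1,2)]
  have choose: "real (n choose 2) = real n * (real n - 1) / 2"
    using binomial_pred_real(2)[of n 2] assms(1) by (simp add: of_nat_diff field_simps)
  have *: "I * (N - (J - 1)) * (N + (J - 1) - I) / (N\<^sup>2 * D) - I * (N - J) * (N + J - I) / (N\<^sup>2 * D)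
      - (I - 1) * (N - (J - 1)) * (N + (J - 1) - (I - 1)) / (N\<^sup>2 * D)
      + (I - 1) * (N - J) * (N + J - (I - 1)) / (N\<^sup>2 * D) = (J - I) / (N * (N * D / 2))"
    if "N \<noteq> 0" "D \<noteq> 0" for I J N D :: real
    using that by (simp add: field_simps power2_eq_square)
  have "measure_pmf.prob \<pi> {w. w ! 0 = j \<and> w ! 1 = i} =
     measure_pmf.prob \<pi> {w. j - 1 < w ! 0 \<and> w ! 1 \<le> i} - measure_pmf.prob \<pi> {w. j < w ! 0 \<and> w ! 1 \<le> i}
     - measure_pmf.prob \<pi> {w. j - 1 < w ! 0 \<and> w ! 1 \<le> i - 1}
     + measure_pmf.prob \<pi> {w. j < w ! 0 \<and> w ! 1 \<le> i - 1}"
    by (rule prob_eq_threshold_differences[OF pos])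
  also have "\<dots> = (real j - real i) / (real n * (real n * (real n - 1) / 2))"
    unfolding D[OF le(1,4)] D[OF le'(1) assms(5)] D[OF le'(2) le(4)] D[OF le'(3) assms(5)] real
    using *[OF n] .
  finally show "measure_pmf.prob \<pi> {w. w ! 0 = j \<and> w ! 1 = i} =
      (real j - real i) / (real n * real (n choose 2))"
    by (simp only: choose)
  have swap: "{w :: nat list. w ! 0 = i \<and> w ! 1 = j} = {w. w ! 1 = j \<and> w ! 0 = i}" by auto
  have "measure_pmf.prob \<pi> {w. w ! 0 = i \<and> w ! 1 = j} =
     measure_pmf.prob \<pi> {w. j - 1 < w ! 1 \<and> w ! 0 \<le> i} - measure_pmf.prob \<pi> {w. j < w ! 1 \<and> w ! 0 \<le> i}
     - measure_pmf.prob \<pi> {w. j - 1 < w ! 1 \<and> w ! 0 \<le> i - 1}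
     + measure_pmf.prob \<pi> {w. j < w ! 1 \<and> w ! 0 \<le> i - 1}"
    unfolding swap by (rule prob_eq_threshold_differences[OF pos])
  \<comment> \<open>Of the four threshold pairs only (i, j - 1) can have equal entries, so a single
    case distinction survives.\<close>
  also have "\<dots> = (if i < j - 1 then real i * (real n - real (j - 1)) / (real n)\<^sup>2
        else real i * (real n - real i) / (real n * (real n - 1)))
      - real i * (real n - real j) / (real n)\<^sup>2
      - (real i - 1) * (real n - (real j - 1)) / (real n)\<^sup>2
      + (real i - 1) * (real n - real j) / (real n)\<^sup>2"
    unfolding U[OF le(1,4)] U[OF le'(1) assms(5)] U[OF le'(2) le(4)] U[OF le'(3) assms(5)]
    using le(2,3) assms(4) by (simp only: if_True real)
  also have "\<dots> = (if i = j - 1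
              then 1 / (real n)\<^sup>2 + real i * (real n - real i) / ((real n)\<^sup>2 * (real n - 1))
              else 1 / (real n)\<^sup>2)"
  proof (cases "i = j - 1")
    case True
    then have j: "real j = real i + 1" "real (j - 1) = real i" "\<not> i < j - 1" using pos by auto
    have **: "I * (N - I) / (N * (N - 1)) - I * (N - (I + 1)) / N\<^sup>2 - (I - 1) * (N - I) / N\<^sup>2
        + (I - 1) * (N - (I + 1)) / N\<^sup>2 = 1 / N\<^sup>2 + I * (N - I) / (N\<^sup>2 * (N - 1))"
      if "N \<noteq> 0" "N - 1 \<noteq> 0" for I N :: real
    proof -
      \<comment> \<open>The diagonal value is split into the off-diagonal formula and the
        jump.\<close>
      have "I * (N - I) / (N * (N - 1)) = I * (N - I) / N\<^sup>2 + I * (N - I) / (N\<^sup>2 * (N - 1))"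
      proof -
        have "X / (N * D) = X / N\<^sup>2 + X / (N\<^sup>2 * D)" if "N = D + 1" "N \<noteq> 0" "D \<noteq> 0" for X D :: real
          unfolding power2_eq_square using that(2,3)
          by (simp add: divide_simps) (simp add: that(1) algebra_simps)
        from this[of "N - 1"] show ?thesis using that by simp
      qed
      moreover have "(I * (N - I) - I * (N - (I + 1)) - (I - 1) * (N - I)
          + (I - 1) * (N - (I + 1))) / N\<^sup>2 = 1 / N\<^sup>2"
        by (rule arg_cong[of _ _ "\<lambda>x. x / N\<^sup>2"]) (simp add: algebra_simps)
      ultimately show ?thesis unfolding diff_divide_distrib add_divide_distrib by linarith
    qed
    show ?thesis unfolding if_P[OF True] if_not_P[OF j(3)] j(1,2) add_diff_cancel_right' using **[OF n] .
  next
    case False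
    then have "i < j - 1" using le by simp
    then show ?thesis using n real by (simp add: field_simps)
  qed
  finally show "measure_pmf.prob \<pi> {w. w ! 0 = i \<and> w ! 1 = j} = (if i = j - 1
              then 1 / (real n)\<^sup>2 + real i * (real n - real i) / ((real n)\<^sup>2 * (real n - 1))
              else 1 / (real n)\<^sup>2)" .
qed

end
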